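(* Let $\mathbf{P}$ be a non-$\Sigma$ operad with $\mathbf{P}(0)=(0)$. The formula $$\forall p\in\mathbf{P}(n),\ p_1,\ldots,p_k\in\mathbf{P},\quad \langle p,p_1\cdots p_k\rangle=\sum_{1\le i_1<\cdots<i_k\le n}p\circ_{i_1,\ldots,i_k}(p_1,\ldots,p_k)$$ defines a brace structure on $\mathbf{P}=\bigoplus_{n\ge1}\mathbf{P}(n)$. It is graded, when the elements of $\mathbf{P}(n)$ are given degree $n-1$, and (if all the $\mathbf{P}(n)$ are finite-dimensional) it is $0$-bounded.
   Context: Vector spaces are over a field of characteristic zero. A non-$\Sigma$ operad is a family of vector spaces $(\mathbf{P}(n))_{n\ge0}$ with associative compositions $p\circ(p_1,\ldots,p_n)\in\mathbf{P}(k_1+\cdots+k_n)$ for $p\in\mathbf{P}(n)$, $p_i\in\mathbf{P}(k_i)$, and a unit $I\in\mathbf{P}(1)$. For distinct $i_1,\ldots,i_k\in[n]$, $p\circ_{i_1,\ldots,i_k}(p_1,\ldots,p_k)=p\circ(p'_1,\ldots,p'_n)$ with $p'_{i_l}=p_l$ and $p'_j=I$ for the other $j$. For $k=0$ the bracket is $\langle p,1\rangle=p$. A brace algebra is a vector space $V$ with a linear map $\langle-,-\rangle:V\otimes T(V)\to V$ such that $\langle x,1\rangle=x$ and, for all $x,y_1,\ldots,y_k\in V$ and all tensors $w\in T(V)$, $$\langle\langle x,y_1\cdots y_k\rangle,w\rangle=\sum_{w=w_1\cdots w_{2k+1}}\langle x,w_1\langle y_1,w_2\rangle w_3\cdots w_{2k-1}\langle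 y_k,w_{2k}\rangle w_{2k+1}\rangle,$$ the sum being over factorizations of $w$ into $2k+1$ possibly empty words. It is extended to a map $T(V)\otimes T(V)\to V$ by $\langle 1,x\rangle=x$ for $x\in V$, $\langle1,v\rangle=0$ for $v\in V^{\otimes l}$, $l\ne1$, and $\langle u,v\rangle=0$ for $u\in V^{\otimes k}$, $k\ge2$. Graded means $V=\bigoplus_{n\ge0}V_n$ with brackets homogeneous of degree $0$. It is $0$-bounded if all $V_n$ are finite-dimensional and for all $m,n\ge0$ there is $B(m,n)\ge0$ such that, for all $p_1+\cdots+p_k=m$, $q_1+\cdots+q_l=n$ ($p_i,q_j\geq 0$): $\sharp\{i\mid p_i=0\}+\sharp\{j\mid q_j=0\}>B(m,n)$ implies $\langle V_{p_1}\cdots V_{p_k},V_{q_1}\cdots V_{q_l}\rangle=(0)$. *)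

theory Defs
  imports Complex_Main "HOL-Library.Poly_Mapping"
begin

context vector_space
begin

text \<open>A linear map out of a tensor product \<open>V\<^sub>1 \<otimes> \<dots> \<otimes> V\<^sub>n\<close> of subspaces
  is represented by the corresponding multilinear map on the lists
  \<open>[x\<^sub>1, \<dots>, x\<^sub>n]\<close> with \<open>x\<^sub>i \<in> V\<^sub>i\<close>; its values on other lists are irrelevant.\<close>

definition multilinear_on :: "'b set list \<Rightarrow> ('b list \<Rightarrow> 'b) \<Rightarrow> bool" where
  "multilinear_on Vs f \<longleftrightarrow>
     (\<forall>xs i c. \<forall>x\<in>Vs ! i. \<forall>y\<in>Vs ! i. list_all2 (\<in>) xs Vs \<longrightarrow> i < length Vs \<longrightarrow>
        f (xs[i := x + y]) = f (xs[i := x]) + f (xs[i := y]) \<and>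
        f (xs[i := scale c x]) = scale c (f (xs[i := x])))"

definition finite_dimensional :: "'b set \<Rightarrow> bool" where
  "finite_dimensional S \<longleftrightarrow> (\<exists>B. finite B \<and> span B = S)"

end


text \<open>The spaces \<open>P n\<close> are subspaces of one ambient vector space and may overlap, so the
  composition \<open>p \<circ> (q\<^sub>1, \<dots>, q\<^sub>n) = \<gamma> ks p [q\<^sub>1, \<dots>, q\<^sub>n]\<close> also takes the list \<open>ks = [k\<^sub>1, \<dots>, k\<^sub>n]\<close> of the
  arities of the \<open>q\<^sub>i\<close>; the arity of \<open>p\<close> is the length of \<open>ks\<close>.\<close>

locale nonsigma_operad = vector_space scale
  for scale :: "'k::field_char_0 \<Rightarrow> 'v::ab_group_add \<Rightarrow> 'v" +
  fixes P :: "nat \<Rightarrow> 'v set"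
    and \<gamma> :: "nat list \<Rightarrow> 'v \<Rightarrow> 'v list \<Rightarrow> 'v"
    and I :: 'v
  assumes subspace_P: "subspace (P n)"
    and comp_closed:
      "p \<in> P (length ks) \<Longrightarrow> list_all2 (\<in>) qs (map P ks) \<Longrightarrow> \<gamma> ks p qs \<in> P (sum_list ks)"
    and comp_multilinear:
      "multilinear_on (P (length ks) # map P ks) (\<lambda>xs. \<gamma> ks (hd xs) (tl xs))"
    and unit_in: "I \<in> P 1"
    and comp_unit_left: "p \<in> P n \<Longrightarrow> \<gamma> [n] I [p] = p"
    and comp_unit_right: "p \<in> P n \<Longrightarrow> \<gamma> (replicate n 1) p (replicate n I) = p"
    and comp_assoc:
      "p \<in> P (length lss) \<Longrightarrow>
       list_all2 (\<in>) qs (map (\<lambda>ls. P (length ls)) lss) \<Longrightarrow>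
       list_all2 (\<lambda>rs ls. list_all2 (\<in>) rs (map P ls)) rss lss \<Longrightarrow>
       \<gamma> (concat lss) (\<gamma> (map length lss) p qs) (concat rss) =
       \<gamma> (map sum_list lss) p
         (map (\<lambda>i. \<gamma> (lss ! i) (qs ! i) (rss ! i)) [0..<length lss])"


locale brace_algebra = vector_space scale
  for scale :: "'k::field_char_0 \<Rightarrow> 'v::ab_group_add \<Rightarrow> 'v" +
  fixes V :: "'v set"
    and br :: "'v \<Rightarrow> 'v list \<Rightarrow> 'v"
  assumes subspace_V: "subspace V"
    and br_closed: "x \<in> V \<Longrightarrow> set ys \<subseteq> V \<Longrightarrow> br x ys \<in> V"
    and br_multilinear: "multilinear_on (replicate (Suc k) V) (\<lambda>xs. br (hd xs) (tl xs))"
    and br_Nil: "x \<in> V \<Longrightarrow> br x [] = x"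
    and br_br:
      "x \<in> V \<Longrightarrow> set ys \<subseteq> V \<Longrightarrow> set w \<subseteq> V \<Longrightarrow>
       br (br x ys) w =
       (\<Sum>ws | length ws = 2 * length ys + 1 \<and> concat ws = w.
          br x (concat (map (\<lambda>i. ws ! (2 * i) @ [br (ys ! i) (ws ! (2 * i + 1))]) [0..<length ys])
                @ ws ! (2 * length ys)))"

text \<open>The extension of the bracket to \<open>T(V) \<otimes> T(V)\<close>, on pairs of words.\<close>

fun extended_bracket :: "('v \<Rightarrow> 'v list \<Rightarrow> 'v::zero) \<Rightarrow> 'v list \<Rightarrow> 'v list \<Rightarrow> 'v" where
  "extended_bracket br [] [x] = x"
| "extended_bracket br [] _ = 0"
| "extended_bracket br [u] vs = br u vs"
| "extended_bracket br (u # u' # us) vs = 0"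

locale graded_brace_algebra = brace_algebra scale V br
  for scale :: "'k::field_char_0 \<Rightarrow> 'v::ab_group_add \<Rightarrow> 'v" and V br +
  fixes D :: "nat \<Rightarrow> 'v set"
  assumes subspace_D: "subspace (D n)"
    and D_subset: "D n \<subseteq> V"
    and decomposition:
      "v \<in> V \<Longrightarrow> \<exists>!f. (\<forall>n. f n \<in> D n) \<and> finite {n. f n \<noteq> 0} \<and> v = (\<Sum>n | f n \<noteq> 0. f n)"
    and br_homogeneous:
      "x \<in> D m \<Longrightarrow> list_all2 (\<in>) ys (map D ns) \<Longrightarrow> br x ys \<in> D (m + sum_list ns)"

locale zero_bounded_brace_algebra = graded_brace_algebra +
  assumes finite_dimensional_D: "finite_dimensional (D n)"
    and zero_bounded:
      "\<exists>B. \<forall>ps qs. sum_list ps = m \<and> sum_list qs = n \<and> count_list ps 0 + count_list qs 0 > B \<longrightarrow>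
         (\<forall>us vs. list_all2 (\<in>) us (map D ps) \<and> list_all2 (\<in>) vs (map D qs) \<longrightarrow>
            extended_bracket br us vs = 0)"


text \<open>The external direct sum of the \<open>P n\<close>, \<open>n \<in> N\<close>: \<open>Poly_Mapping.single n p\<close> is the element
  \<open>p \<in> P n\<close> placed in the \<open>n\<close>-th summand.\<close>

definition direct_sum :: "nat set \<Rightarrow> (nat \<Rightarrow> 'v set) \<Rightarrow> (nat \<Rightarrow>\<^sub>0 'v::zero) set" where
  "direct_sum N P = {f. Poly_Mapping.keys f \<subseteq> N \<and> (\<forall>n\<in>N. Poly_Mapping.lookup f n \<in> P n)}"

definition direct_sum_scale ::
  "('k \<Rightarrow> 'v \<Rightarrow> 'v) \<Rightarrow> 'k \<Rightarrow> (nat \<Rightarrow>\<^sub>0 'v::zero) \<Rightarrow> (nat \<Rightarrow>\<^sub>0 'v)" where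
  "direct_sum_scale scale c = Poly_Mapping.map (scale c)"

text \<open>The list of length \<open>n\<close> with \<open>xs ! l\<close> at the (1-based) position \<open>js ! l\<close> and \<open>d\<close>
  elsewhere.\<close>

definition place :: "nat \<Rightarrow> nat list \<Rightarrow> 'a list \<Rightarrow> 'a \<Rightarrow> 'a list" where
  "place n js xs d =
     map (\<lambda>j. case map_of (zip js xs) j of Some x \<Rightarrow> x | None \<Rightarrow> d) [1..<Suc n]"

text \<open>\<open>p \<circ>\<^bsub>j\<^sub>1,\<dots>,j\<^sub>k\<^esub> (q\<^sub>1, \<dots>, q\<^sub>k)\<close> for \<open>p \<in> P n\<close> and \<open>q\<^sub>i \<in> P k\<^sub>i\<close>, as an element of
  the direct sum.\<close>

definition partial_comp ::
  "(nat list \<Rightarrow> 'v \<Rightarrow> 'v list \<Rightarrow> 'v) \<Rightarrow> 'v \<Rightarrow> nat \<Rightarrow> 'v \<Rightarrow> nat list \<Rightarrow> nat list \<Rightarrow> 'v list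
     \<Rightarrow> (nat \<Rightarrow>\<^sub>0 'v::zero)" where
  "partial_comp \<gamma> I n p js ks qs =
     Poly_Mapping.single (sum_list (place n js ks 1))
       (\<gamma> (place n js ks 1) p (place n js qs I))"

definition increasing_seqs :: "nat \<Rightarrow> nat \<Rightarrow> nat list set" where
  "increasing_seqs k n = {js. length js = k \<and> sorted_wrt (<) js \<and> set js \<subseteq> {1..n}}"

text \<open>The multilinear extension to the direct sum of
  \<open>\<langle>p, q\<^sub>1 \<dots> q\<^sub>k\<rangle> = \<Sum>\<^bsub>1 \<le> j\<^sub>1 < \<dots> < j\<^sub>k \<le> n\<^esub> p \<circ>\<^bsub>j\<^sub>1,\<dots>,j\<^sub>k\<^esub> (q\<^sub>1, \<dots>, q\<^sub>k)\<close>: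
  sum over the homogeneous components of all arguments.\<close>

definition operad_bracket ::
  "(nat list \<Rightarrow> 'v \<Rightarrow> 'v list \<Rightarrow> 'v) \<Rightarrow> 'v \<Rightarrow> (nat \<Rightarrow>\<^sub>0 'v::ab_group_add) \<Rightarrow> (nat \<Rightarrow>\<^sub>0 'v) list
     \<Rightarrow> (nat \<Rightarrow>\<^sub>0 'v)" where
  "operad_bracket \<gamma> I p qs =
     (\<Sum>n\<in>Poly_Mapping.keys p. \<Sum>ks\<in>listset (map Poly_Mapping.keys qs).
        \<Sum>js\<in>increasing_seqs (length qs) n.
          partial_comp \<gamma> I n (Poly_Mapping.lookup p n) js ks (map2 Poly_Mapping.lookup qs ks))"

definition operad_grading :: "(nat \<Rightarrow> 'v set) \<Rightarrow> nat \<Rightarrow> (nat \<Rightarrow>\<^sub>0 'v::zero) set" where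
  "operad_grading P d = Poly_Mapping.single (d + 1) ` P (d + 1)"

end

theory Submission
  imports Defs
begin

text \<open>Let \<open>slot e\<close> send the empty word to \<open>e\<close>, a letter to itself and all longer words to \<open>0\<close>.
  With \<open>e\<close> the operadic unit, the bracket becomes a sum over all factorizations of the word,
  \<open>\<langle>p, w\<rangle> = \<Sum> p \<circ> (slot e b\<^sub>1, \<dots>, slot e b\<^sub>n)\<close> over \<open>w = b\<^sub>1\<cdots>b\<^sub>n\<close>, and \<open>\<langle>e, w\<rangle> = slot e w\<close>.
  Associativity and multilinearity of the composition then give
  \<open>\<langle>p \<circ> (r\<^sub>1, \<dots>, r\<^sub>n), w\<rangle> = \<Sum> p \<circ> (\<langle>r\<^sub>1, w\<^sub>1\<rangle>, \<dots>, \<langle>r\<^sub>n, w\<^sub>n\<rangle>)\<close> over \<open>w = w\<^sub>1\<cdots>w\<^sub>n\<close>.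
  Applied to the terms of \<open>\<langle>p, y\<^sub>1\<cdots>y\<^sub>k\<rangle>\<close>, this reduces the brace identity to a reindexing of
  factorizations, by induction on the arity \<open>n\<close>. The bracket is \<open>0\<close>-bounded because an element
  of arity \<open>n\<close> is killed by words of more than \<open>n\<close> letters.\<close>

section \<open>Sums over factorizations of words\<close>

definition factorizations :: "nat \<Rightarrow> 'a list \<Rightarrow> 'a list list set" where
  "factorizations n w = {ws. length ws = n \<and> concat ws = w}"

lemma factorizations_0: "factorizations 0 w = (if w = [] then {[]} else {})"
  by (auto simp: factorizations_def)

lemma factorizations_1: "factorizations (Suc 0) w = {[w]}"
  by (auto simp: factorizations_def length_Suc_conv)

text \<open>Every factor is a contiguous subword, hence of the form \<open>take i (drop j w)\<close>
  with \<open>i\<close> and \<open>j\<close> at most \<open>length w\<close>.\<close>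

lemma finite_factorizations: "finite (factorizations n w)"
proof (rule finite_subset)
  show "factorizations n w \<subseteq> {ws. set ws \<subseteq> (\<lambda>(i, j). take i (drop j w)) ` ({..length w} \<times> {..length w}) \<and> length ws = n}"
  proof (safe, goal_cases)
    case (1 ws u)
    then obtain as bs where "ws = as @ u # bs" by (meson split_list)
    with 1 have w: "w = concat as @ u @ concat bs" by (simp add: factorizations_def)
    then have "u = take (length u) (drop (length (concat as)) w)" by simp
    moreover have "length u \<le> length w" "length (concat as) \<le> length w" using w by simp_all
    ultimately show ?case by force
  qed (simp add: factorizations_def)
qed (simp add: finite_lists_length_eq)

text \<open>A factorization is cut after its first \<open>m\<close> words. The index
  \<open>i\<close> records the length of the prefix of \<open>w\<close> that they cover, and this
  makes the cut reversible.\<close>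

lemma sum_factorizations_add:
  fixes f :: "'a list list \<Rightarrow> 'b::comm_monoid_add"
  shows "(\<Sum>ws\<in>factorizations (m + n) w. f ws) =
    (\<Sum>i\<le>length w. \<Sum>us\<in>factorizations m (take i w). \<Sum>vs\<in>factorizations n (drop i w). f (us @ vs))"
proof -
  have B: "concat (take m ws) @ concat (drop m ws) = concat ws" for ws :: "'a list list"
    by (metis append_take_drop_id concat_append)
  then have C: "take (length (concat (take m ws))) (concat ws) = concat (take m ws)"
    "drop (length (concat (take m ws))) (concat ws) = concat (drop m ws)"
    "length (concat (take m ws)) \<le> length (concat ws)" for ws :: "'a list list"
    by (metis append_eq_conv_conj, metis append_eq_conv_conj, metis le_add1 length_append)
  let ?S = "SIGMA i:{..length w}. factorizations m (take i w) \<times> factorizations n (drop i w)"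
  have "(\<Sum>ws\<in>factorizations (m + n) w. f ws) = (\<Sum>(i, us, vs)\<in>?S. f (us @ vs))"
  proof (rule sum.reindex_bij_witness
        [of _ "\<lambda>(i, us, vs). us @ vs" "\<lambda>ws. (length (concat (take m ws)), take m ws, drop m ws)"])
    fix ws assume "ws \<in> factorizations (m + n) w"
    then show "(length (concat (take m ws)), take m ws, drop m ws) \<in> ?S"
      using C[of ws] by (simp add: factorizations_def del: length_concat)
  next
    fix x assume "x \<in> ?S"
    then obtain i us vs where x: "x = (i, us, vs)" and i: "i \<le> length w"
      and us: "length us = m" "concat us = take i w" and vs: "length vs = n" "concat vs = drop i w"
      by (auto simp: factorizations_def)
    show "(case x of (i, us, vs) \<Rightarrow> us @ vs) \<in> factorizations (m + n) w"
      using us vs by (simp add: x factorizations_def)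
    have "length (concat us) = i" using us i by simp
    then show "(length (concat (take m (case x of (i, us, vs) \<Rightarrow> us @ vs))),
        take m (case x of (i, us, vs) \<Rightarrow> us @ vs), drop m (case x of (i, us, vs) \<Rightarrow> us @ vs)) = x"
      using us by (simp add: x del: length_concat)
  qed simp_all
  then show ?thesis
    by (simp add: sum.cartesian_product sum.Sigma finite_factorizations)
qed

lemma sum_factorizations_Suc:
  fixes f :: "'a list list \<Rightarrow> 'b::comm_monoid_add"
  shows "(\<Sum>ws\<in>factorizations (Suc n) w. f ws) =
    (\<Sum>i\<le>length w. \<Sum>ws\<in>factorizations n (drop i w). f (take i w # ws))"
  using sum_factorizations_add[of f "Suc 0" n w] by (simp add: factorizations_1)

lemma in_factorizations_set: "ws \<in> factorizations n w \<Longrightarrow> u \<in> set ws \<Longrightarrow> set u \<subseteq> set w"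
  by (auto simp: factorizations_def)

section \<open>Sums over Cartesian products of index sets\<close>

lemma sum_listset_Cons:
  "(\<Sum>as\<in>listset (A # As). f as) = (\<Sum>a\<in>A. \<Sum>as\<in>listset As. f (a # as))"
proof -
  have "listset (A # As) = (\<lambda>(a, as). a # as) ` (A \<times> listset As)"
    by (auto simp: set_Cons_def)
  moreover have "inj_on (\<lambda>(a, as). a # as) (A \<times> listset As)" by (auto simp: inj_on_def)
  ultimately show ?thesis by (simp add: sum.reindex sum.cartesian_product case_prod_unfold)
qed

lemma in_listset_iff: "as \<in> listset As \<longleftrightarrow> list_all2 (\<in>) as As"
  by (induction As arbitrary: as) (auto simp: set_Cons_def list_all2_Cons2)

lemma listset_append_sum:
  "(\<Sum>as\<in>listset (As @ Bs). f as) = (\<Sum>as\<in>listset As. \<Sum>bs\<in>listset Bs. f (as @ bs))"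
  by (induction As arbitrary: f) (simp_all add: sum_listset_Cons del: listset.simps(2))

lemma sum_listset_concat:
  "(\<Sum>as\<in>listset (concat Ass). f as) = (\<Sum>ass\<in>listset (map listset Ass). f (concat ass))"
  by (induction Ass arbitrary: f) (simp_all add: sum_listset_Cons listset_append_sum del: listset.simps(2))

text \<open>Two-level factorization: \<open>w\<close> is first cut into one block per entry of
  \<open>ks\<close>, then each block into the prescribed number of words. This groups the inputs of
  a composite operation by the inner operation to which they belong.\<close>

lemma sum_factorizations_sum_list:
  "(\<Sum>bs\<in>factorizations (sum_list ks) w. f bs) =
   (\<Sum>ws\<in>factorizations (length ks) w. \<Sum>bss\<in>listset (map2 factorizations ks ws). f (concat bss))"
proof (induction ks arbitrary: w f)
  case Nil
  then show ?case by (simp add: factorizations_0)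
next
  case (Cons k ks)
  show ?case
    by (simp add: sum_factorizations_add sum_factorizations_Suc Cons sum_listset_Cons
        sum.swap[of _ "factorizations k _"] del: listset.simps(2))
qed

section \<open>Slots and the reindexing behind the brace identity\<close>

definition slot :: "'a \<Rightarrow> 'a list \<Rightarrow> 'a::zero" where
  "slot e b = (case b of [] \<Rightarrow> e | [q] \<Rightarrow> q | _ \<Rightarrow> 0)"

lemma slot_simps [simp]: "slot e [] = e" "slot e [q] = q" "slot e (q # q' # b) = 0"
  by (simp_all add: slot_def)

text \<open>Only the cuts at \<open>i = 0\<close> and \<open>i = 1\<close> survive, because
  \<open>h\<close> vanishes once its first word has two letters.\<close>

lemma sum_split_short:
  fixes h :: "'a list \<Rightarrow> 'a list \<Rightarrow> 'b::comm_monoid_add"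
  assumes "\<And>a b u v. h (a # b # u) v = 0"
  shows "(\<Sum>i\<le>length w. h (take i w) (drop i w)) =
    h [] w + (case w of [] \<Rightarrow> 0 | x # w' \<Rightarrow> h [x] w')"
proof -
  have "(\<Sum>i\<le>length w. h (x # take i w) (drop i w)) = h [x] w" for x w
    by (cases w) (simp_all add: assms sum.atMost_Suc_shift del: sum.atMost_Suc)
  then show ?thesis by (cases w) (simp_all add: sum.atMost_Suc_shift del: sum.atMost_Suc)
qed

text \<open>The first word is empty and contributes \<open>e\<close>, or it is the first letter of
  \<open>w\<close>; a longer first word puts a 0 into the list, and \<open>F\<close> kills
  it.\<close>

lemma sum_slot_Suc:
  fixes F :: "'a::zero list \<Rightarrow> 'b::comm_monoid_add"
  assumes "\<And>zs. 0 \<in> set zs \<Longrightarrow> F zs = 0"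
  shows "(\<Sum>bss\<in>factorizations (Suc n) w. F (map (slot e) bss)) =
    (\<Sum>bss\<in>factorizations n w. F (e # map (slot e) bss)) +
    (case w of [] \<Rightarrow> 0 | x # w' \<Rightarrow> \<Sum>bss\<in>factorizations n w'. F (x # map (slot e) bss))"
  using assms
  by (simp add: sum_factorizations_Suc
      sum_split_short[where h = "\<lambda>u v. \<Sum>bss\<in>factorizations n v. F (slot e u # map (slot e) bss)"]
      split: list.split)

text \<open>The word to which \<open>x\<close> is applied on the right of the brace identity, with
  \<open>g\<close> in place of the bracket. Entries of \<open>ws\<close> with even index are the
  gaps, those with odd index the words given to the letters of \<open>ys\<close>.\<close>

definition inserted :: "('a \<Rightarrow> 'a list \<Rightarrow> 'a) \<Rightarrow> 'a list \<Rightarrow> 'a list list \<Rightarrow> 'a list" where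
  "inserted g ys ws = concat (map (\<lambda>i. ws ! (2 * i) @ [g (ys ! i) (ws ! (2 * i + 1))]) [0..<length ys])
     @ ws ! (2 * length ys)"

lemma inserted_Nil [simp]: "inserted g [] (a # ws) = a"
  by (simp add: inserted_def)

lemma inserted_Cons [simp]: "inserted g (y # ys) (a # u # ws) = a @ g y u # inserted g ys ws"
proof -
  have "[0..<Suc (length ys)] = 0 # map Suc [0..<length ys]"
    by (simp add: upt_conv_Cons map_Suc_upt del: upt_Suc)
  then show ?thesis by (simp add: inserted_def comp_def del: upt_Suc)
qed

text \<open>Both sides satisfy the same recursion in \<open>n\<close>: the first slot is empty, or receives the
  first letter of \<open>w\<close>, or receives \<open>y\<^sub>1\<close> together with a prefix of \<open>w\<close>.\<close>

lemma sum_slot_inserted: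
  fixes F :: "'a::zero list \<Rightarrow> 'b::comm_monoid_add"
  assumes F0: "\<And>zs. 0 \<in> set zs \<Longrightarrow> F zs = 0"
    and g0: "\<And>u. set u \<subseteq> S \<Longrightarrow> g 0 u = 0"
    and ge: "\<And>u. set u \<subseteq> S \<Longrightarrow> g e u = slot e u"
    and "set w \<subseteq> S"
  shows "(\<Sum>bss\<in>factorizations n ys. \<Sum>ws\<in>factorizations n w. F (map2 (\<lambda>b u. g (slot e b) u) bss ws)) =
    (\<Sum>ws\<in>factorizations (2 * length ys + 1) w. \<Sum>bss\<in>factorizations n (inserted g ys ws). F (map (slot e) bss))"
  using F0 \<open>set w \<subseteq> S\<close>
proof (induction n arbitrary: ys w F)
  case 0
  show ?case
  proof (cases ys)
    case Nil
    then show ?thesis by (simp add: factorizations_0 factorizations_1)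
  next
    case (Cons y ys')
    then show ?thesis 
      by (simp add: factorizations_0 sum_factorizations_Suc)
  qed
next
  case (Suc n)
  note F0 = Suc.prems(1) and w = Suc.prems(2)
  let ?L = "\<lambda>ys w F. \<Sum>bss\<in>factorizations n ys. \<Sum>ws\<in>factorizations n w. F (map2 (\<lambda>b u. g (slot e b) u) bss ws)"
  let ?Q = "\<lambda>W F. \<Sum>bss\<in>factorizations n W. F (map (slot e) bss)"
  let ?R = "\<lambda>ys w F. \<Sum>ws\<in>factorizations (2 * length ys + 1) w. ?Q (inserted g ys ws) F"
  \<comment> \<open>The value in the first slot is frozen: \<open>F (z # zs)\<close>, as a function
    of \<open>zs\<close>, again vanishes on lists containing 0, so the induction hypothesis applies
    to it.\<close>
  have IH: "?L ys w (\<lambda>zs. F (z # zs)) = ?R ys w (\<lambda>zs. F (z # zs))" if "set w \<subseteq> S" for ys w z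
    using that F0 by (intro Suc.IH) auto
  have sub: "set (take i w) \<subseteq> S" "set (drop i w) \<subseteq> S" for i
    using w set_take_subset set_drop_subset by fastforce+
  \<comment> \<open>\<open>?T\<close> collects the two cases with a nonempty first slot: it receives
    the first letter of \<open>w\<close>, or a value of \<open>g\<close> at the first letter of
    \<open>ys\<close>.\<close>
  let ?T = "(case w of [] \<Rightarrow> 0 | x # w' \<Rightarrow> ?R ys w' (\<lambda>zs. F (x # zs))) +
    (case ys of [] \<Rightarrow> 0 | y # ys' \<Rightarrow> \<Sum>i\<le>length w. ?R ys' (drop i w) (\<lambda>zs. F (g y (take i w) # zs)))"
  have "(\<Sum>bss\<in>factorizations (Suc n) ys. \<Sum>ws\<in>factorizations (Suc n) w. F (map2 (\<lambda>b u. g (slot e b) u) bss ws))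
    = (\<Sum>j\<le>length ys. \<Sum>i\<le>length w. ?L (drop j ys) (drop i w) (\<lambda>zs. F (g (slot e (take j ys)) (take i w) # zs)))"
    by (simp add: sum_factorizations_Suc sum.swap[of _ "factorizations n _" "{..length w}"])
  \<comment> \<open>The first word of the factorization of \<open>ys\<close> is empty or a single
    letter; a longer one gives \<open>g 0\<close>, which is 0.\<close>
  also have "\<dots> = (\<Sum>i\<le>length w. ?L ys (drop i w) (\<lambda>zs. F (g e (take i w) # zs))) +
    (case ys of [] \<Rightarrow> 0 | y # ys' \<Rightarrow> \<Sum>i\<le>length w. ?L ys' (drop i w) (\<lambda>zs. F (g y (take i w) # zs)))"
    by (subst sum_split_short[where h = "\<lambda>u v. \<Sum>i\<le>length w. ?L v (drop i w) (\<lambda>zs. F (g (slot e u) (take i w) # zs))"])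
      (simp_all add: F0 g0 sub cong: list.case_cong)
  also have "(\<Sum>i\<le>length w. ?L ys (drop i w) (\<lambda>zs. F (g e (take i w) # zs))) =
      (\<Sum>i\<le>length w. ?L ys (drop i w) (\<lambda>zs. F (slot e (take i w) # zs)))"
    by (simp add: ge sub)
  \<comment> \<open>Since \<open>g e\<close> has become \<open>slot e\<close>, the prefix of
    \<open>w\<close> must also be empty or a single letter.\<close>
  also have "\<dots> = ?L ys w (\<lambda>zs. F (e # zs)) + (case w of [] \<Rightarrow> 0 | x # w' \<Rightarrow> ?L ys w' (\<lambda>zs. F (x # zs)))"
    by (subst sum_split_short[where h = "\<lambda>u v. ?L ys v (\<lambda>zs. F (slot e u # zs))"])
      (simp_all add: F0 cong: list.case_cong)
  also have "\<dots> = ?R ys w (\<lambda>zs. F (e # zs)) + (case w of [] \<Rightarrow> 0 | x # w' \<Rightarrow> ?R ys w' (\<lambda>zs. F (x # zs)))"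
    using w by (subst IH[OF w]) (cases w; simp add: IH)
  also have "(case ys of [] \<Rightarrow> 0 | y # ys' \<Rightarrow> \<Sum>i\<le>length w. ?L ys' (drop i w) (\<lambda>zs. F (g y (take i w) # zs))) =
    (case ys of [] \<Rightarrow> 0 | y # ys' \<Rightarrow> \<Sum>i\<le>length w. ?R ys' (drop i w) (\<lambda>zs. F (g y (take i w) # zs)))"
    by (simp only: IH[OF sub(2)])
  also have "(?R ys w (\<lambda>zs. F (e # zs)) + (case w of [] \<Rightarrow> 0 | x # w' \<Rightarrow> ?R ys w' (\<lambda>zs. F (x # zs)))) +
    (case ys of [] \<Rightarrow> 0 | y # ys' \<Rightarrow> \<Sum>i\<le>length w. ?R ys' (drop i w) (\<lambda>zs. F (g y (take i w) # zs)))
    = ?R ys w (\<lambda>zs. F (e # zs)) + ?T" by (simp only: add.assoc)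
  also have "?T = (\<Sum>ws\<in>factorizations (2 * length ys + 1) w.
      case inserted g ys ws of [] \<Rightarrow> 0 | x # W \<Rightarrow> ?Q W (\<lambda>zs. F (x # zs)))"
  proof (cases ys)
    case Nil
    then show ?thesis by (simp add: factorizations_1 split: list.split)
  next
    \<comment> \<open>If the leading gap is empty, the inserted word starts with a value of
      \<open>g y\<close>; otherwise it starts with the first letter of \<open>w\<close>, and
      removing that letter leaves an inserted word built from the rest of \<open>w\<close>.\<close>
    case (Cons y ys')
    then show ?thesis
      by (cases w) (simp_all add: sum_factorizations_Suc sum.atMost_Suc_shift add.commute del: sum.atMost_Suc)
  qed
  finally show ?case
    by (simp add: sum_slot_Suc[where F = F, OF F0] sum.distrib)
qed

section \<open>Multilinear maps\<close>

context vector_space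
begin

lemma multilinear_on_Nil [simp]: "multilinear_on [] f"
  by (simp add: multilinear_on_def)

text \<open>Separates linearity in the first entry from multilinearity in the others with the first
  entry frozen. Inductions on argument lists run through this form.\<close>

lemma multilinear_on_Cons:
  assumes "subspace W"
  shows "multilinear_on (W # Ws) f \<longleftrightarrow>
    (\<forall>x\<in>W. \<forall>y\<in>W. \<forall>xs c. list_all2 (\<in>) xs Ws \<longrightarrow>
       f ((x + y) # xs) = f (x # xs) + f (y # xs) \<and> f (scale c x # xs) = scale c (f (x # xs))) \<and>
    (\<forall>a\<in>W. multilinear_on Ws (\<lambda>xs. f (a # xs)))"
    (is "?L \<longleftrightarrow> ?A \<and> ?B")
proof (intro iffI conjI)
  assume L: ?L
  show ?A
  proof (intro ballI allI impI)
    fix x y xs c assume "x \<in> W" "y \<in> W" "list_all2 (\<in>) xs Ws"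
    then show "f ((x + y) # xs) = f (x # xs) + f (y # xs) \<and> f (scale c x # xs) = scale c (f (x # xs))"
      using L[unfolded multilinear_on_def, rule_format, where i = 0 and xs = "x # xs" and x = x and y = y and c = c]
      by simp
  qed
  show ?B
  proof
    fix a assume a: "a \<in> W"
    show "multilinear_on Ws (\<lambda>xs. f (a # xs))"
      unfolding multilinear_on_def
    proof (intro allI ballI impI)
      fix xs i c x y
      assume "x \<in> Ws ! i" "y \<in> Ws ! i" "list_all2 (\<in>) xs Ws" "i < length Ws"
      then show "f (a # xs[i := x + y]) = f (a # xs[i := x]) + f (a # xs[i := y]) \<and>
          f (a # xs[i := scale c x]) = scale c (f (a # xs[i := x]))"
        using L[unfolded multilinear_on_def, rule_format,
            where i = "Suc i" and xs = "a # xs" and x = x and y = y and c = c] a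
        by simp
    qed
  qed
next
  assume AB: "?A \<and> ?B"
  show ?L
    unfolding multilinear_on_def
  proof (intro allI ballI impI)
    fix xs i c x y
    assume *: "x \<in> (W # Ws) ! i" "y \<in> (W # Ws) ! i" "list_all2 (\<in>) xs (W # Ws)" "i < length (W # Ws)"
    then obtain a as where xs: "xs = a # as" and a: "a \<in> W" "list_all2 (\<in>) as Ws"
      by (auto simp: list_all2_Cons2)
    show "f (xs[i := x + y]) = f (xs[i := x]) + f (xs[i := y]) \<and>
          f (xs[i := scale c x]) = scale c (f (xs[i := x]))"
    proof (cases i)
      case 0
      then show ?thesis using AB * a xs by simp
    next
      case (Suc j)
      have "multilinear_on Ws (\<lambda>xs. f (a # xs))" using AB a by blast
      from this[unfolded multilinear_on_def, rule_format, of x j y as c]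
      show ?thesis using * a xs Suc by simp
    qed
  qed
qed

lemma multilinear_on_const_0 [simp]: "multilinear_on Ws (\<lambda>_. 0)"
  by (simp add: multilinear_on_def)

lemma multilinear_on_add:
  "multilinear_on Ws f \<Longrightarrow> multilinear_on Ws g \<Longrightarrow> multilinear_on Ws (\<lambda>xs. f xs + g xs)"
  by (simp add: multilinear_on_def scale_right_distrib algebra_simps)

lemma multilinear_on_sum:
  "(\<And>i. i \<in> A \<Longrightarrow> multilinear_on Ws (f i)) \<Longrightarrow> multilinear_on Ws (\<lambda>xs. \<Sum>i\<in>A. f i xs)"
  by (induction A rule: infinite_finite_induct) (simp_all add: multilinear_on_add)

text \<open>The definition only evaluates the maps on lists updated by elements of the spaces, their
  sums and their multiples; subspaces are closed under both operations.\<close>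

lemma multilinear_on_cong:
  assumes W: "\<And>W. W \<in> set Ws \<Longrightarrow> subspace W"
    and eq: "\<And>xs. list_all2 (\<in>) xs Ws \<Longrightarrow> f xs = g xs"
  shows "multilinear_on Ws f \<longleftrightarrow> multilinear_on Ws g"
proof -
  have upd: "f (xs[i := z]) = g (xs[i := z])" if "z \<in> Ws ! i" "list_all2 (\<in>) xs Ws" for xs i z
  proof (cases "i < length Ws")
    case True
    with that show ?thesis by (metis eq list_all2_update_cong list_update_id)
  next
    case False
    with that show ?thesis by (simp add: eq list_all2_lengthD list_update_beyond)
  qed
  have "x + y \<in> Ws ! i" "scale c x \<in> Ws ! i" if "x \<in> Ws ! i" "y \<in> Ws ! i" "i < length Ws" for x y c i
    using that W subspace_add subspace_scale nth_mem by blast+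
  with upd show ?thesis unfolding multilinear_on_def by (metis (no_types, lifting))
qed

text \<open>Scaling the zero entry by the scalar 0 leaves the list unchanged, while linearity in
  that entry multiplies the value by 0.\<close>

lemma multilinear_on_zero:
  assumes "multilinear_on Ws f" "list_all2 (\<in>) xs Ws" "0 \<in> set xs"
  shows "f xs = 0"
proof -
  obtain i where i: "i < length xs" "xs ! i = 0" using assms(3) by (auto simp: in_set_conv_nth)
  then have "0 \<in> Ws ! i" "i < length Ws" using assms(2) by (auto simp: list_all2_conv_all_nth)
  then have "f (xs[i := scale 0 0]) = scale 0 (f (xs[i := 0]))"
    using assms(1,2) unfolding multilinear_on_def by blast
  then show ?thesis using i list_update_id[of xs i] by simp
qed

lemma multilinear_on_sum_hd:
  assumes "subspace W" "multilinear_on (W # Ws) f" "list_all2 (\<in>) xs Ws" "\<And>i. i \<in> A \<Longrightarrow> h i \<in> W"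
  shows "f ((\<Sum>i\<in>A. h i) # xs) = (\<Sum>i\<in>A. f (h i # xs))"
proof -
  \<comment> \<open>Covers the empty index set and also infinite ones, whose sums are 0 by
    convention.\<close>
  have f0: "f (0 # xs) = 0"
    using multilinear_on_zero[of "W # Ws" f "0 # xs"] assms subspace_0 by simp
  show ?thesis using assms(4)
  proof (induction A rule: infinite_finite_induct)
    case (insert i A)
    then have "(\<Sum>i\<in>A. h i) \<in> W" by (simp add: subspace_sum assms(1))
    then show ?case using insert assms(2,3) by (simp add: multilinear_on_Cons[OF assms(1)])
  qed (simp_all add: f0)
qed

text \<open>The distributive law for a multilinear map. The spaces, index sets and summands depend
  on labels \<open>a\<close>, so that the labels can be pairs or triples zipped together from
  several lists.\<close>

lemma multilinear_on_expand:
  assumes "multilinear_on (map W as) f" "\<And>a. a \<in> set as \<Longrightarrow> subspace (W a)"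
    and "\<And>a i. a \<in> set as \<Longrightarrow> i \<in> A a \<Longrightarrow> h a i \<in> W a"
  shows "f (map (\<lambda>a. \<Sum>i\<in>A a. h a i) as) = (\<Sum>is\<in>listset (map A as). f (map2 h as is))"
  using assms
proof (induction as arbitrary: f)
  case (Cons a as)
  note sub = Cons.prems(2)[of a, simplified]
  have mem: "list_all2 (\<in>) (map (\<lambda>a. \<Sum>i\<in>A a. h a i) as) (map W as)"
    using Cons.prems by (auto simp: list_all2_conv_all_nth intro!: subspace_sum)
  have "f (map (\<lambda>a. \<Sum>i\<in>A a. h a i) (a # as)) =
      (\<Sum>i\<in>A a. f (h a i # map (\<lambda>a. \<Sum>i\<in>A a. h a i) as))"
    using multilinear_on_sum_hd[OF sub _ mem, of f "A a" "h a"] Cons.prems(1,3) by simp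
  also have "\<dots> = (\<Sum>i\<in>A a. \<Sum>is\<in>listset (map A as). f (h a i # map2 h as is))"
    by (intro sum.cong Cons.IH[of "\<lambda>xs. f (_ # xs)"])
      (use Cons.prems in \<open>auto simp: multilinear_on_Cons[OF sub]\<close>)
  finally show ?case by (simp add: sum_listset_Cons del: listset.simps(2))
qed simp

text \<open>By \<open>sum_slot_Suc\<close>, the first slot holds \<open>e\<close> or the first
  argument. Freezing its content in \<open>F\<close> reduces both summands to \<open>n\<close>
  slots, and linearity of \<open>F\<close> in its first entry settles the first argument.\<close>

lemma multilinear_on_slots:
  assumes W: "subspace W" and "e \<in> W"
    and "multilinear_on (replicate n W) F" "\<And>zs. 0 \<in> set zs \<Longrightarrow> F zs = 0"
  shows "multilinear_on (replicate k W) (\<lambda>ws. \<Sum>bss\<in>factorizations n ws. F (map (slot e) bss))"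
  using assms(3,4)
proof (induction n arbitrary: k F)
  case 0
  show ?case
    by (cases k) (auto simp: factorizations_0 multilinear_on_Cons[OF W] W scale_zero_right
        intro!: multilinear_on_const_0)
next
  case (Suc n)
  let ?Q = "\<lambda>a ws. \<Sum>bss\<in>factorizations n ws. F (a # map (slot e) bss)"
  have lin: "F ((x + y) # xs) = F (x # xs) + F (y # xs)" "F (scale c x # xs) = scale c (F (x # xs))"
    if "x \<in> W" "y \<in> W" "list_all2 (\<in>) xs (replicate n W)" for x y xs c
    using Suc.prems(1) that by (auto simp: multilinear_on_Cons[OF W])
  have Q: "multilinear_on (replicate k W) (?Q a)" if "a \<in> W" for a k
    using Suc.prems that by (intro Suc.IH) (auto simp: multilinear_on_Cons[OF W])
  have mem: "list_all2 (\<in>) (map (slot e) bss) (replicate n W)"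
    if "list_all2 (\<in>) ws (replicate k W)" "bss \<in> factorizations n ws" for bss ws k
  proof -
    have "slot e b \<in> W" if "b \<in> set bss" for b
    proof -
      have "set b \<subseteq> W"
        using \<open>list_all2 (\<in>) ws (replicate k W)\<close> in_factorizations_set[OF \<open>bss \<in> _\<close> that]
        by (fastforce simp: list_all2_conv_all_nth in_set_conv_nth)
      then show ?thesis using \<open>e \<in> W\<close> subspace_0[OF W]
        by (auto simp: slot_def split: list.split)
    qed
    moreover have "length bss = n" using that by (simp add: factorizations_def)
    ultimately show ?thesis by (simp add: list_all2_conv_all_nth)
  qed
  have "multilinear_on (replicate k W) (\<lambda>ws. ?Q e ws + (case ws of [] \<Rightarrow> 0 | x # ws' \<Rightarrow> ?Q x ws'))"
  proof (rule multilinear_on_add[OF Q[OF \<open>e \<in> W\<close>]])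
    show "multilinear_on (replicate k W) (\<lambda>ws. case ws of [] \<Rightarrow> 0 | x # ws' \<Rightarrow> ?Q x ws')"
      using Q by (cases k) (auto simp: multilinear_on_Cons[OF W] lin mem sum.distrib scale_sum_right)
  qed
  then show ?case by (simp add: sum_slot_Suc[where F = F, OF Suc.prems(2)])
qed

end

section \<open>Increasing sequences of inputs\<close>

lemma (in vector_space) lookup_direct_sum_scale:
  "Poly_Mapping.lookup (direct_sum_scale scale c x) k = scale c (Poly_Mapping.lookup x k)"
  by (simp add: direct_sum_scale_def Poly_Mapping.map.rep_eq when_def)

lemma (in vector_space) vector_space_direct_sum_scale:
  "vector_space (direct_sum_scale scale :: _ \<Rightarrow> (nat \<Rightarrow>\<^sub>0 'b) \<Rightarrow> _)"
  by unfold_locales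
    (auto intro!: poly_mapping_eqI simp: lookup_direct_sum_scale lookup_add scale_right_distrib scale_left_distrib)

section \<open>Recursion on the number of available positions\<close>

lemma finite_increasing_seqs: "finite (increasing_seqs k n)"
  by (rule finite_subset[OF _ finite_lists_length_eq[of "{1..n}" k]])
    (auto simp: increasing_seqs_def)

lemma increasing_seqs_0: "increasing_seqs k 0 = (if k = 0 then {[]} else {})"
  by (auto simp: increasing_seqs_def)

text \<open>Position 1 is either avoided or used. As the sequence increases, it can be used only by
  the head, and all remaining entries are at least 2, hence shifted by \<open>Suc\<close>.\<close>

lemma increasing_seqs_Suc:
  "increasing_seqs k (Suc n) = map Suc ` increasing_seqs k n \<union>
     (case k of 0 \<Rightarrow> {} | Suc k' \<Rightarrow> (\<lambda>js. 1 # map Suc js) ` increasing_seqs k' n)"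
    (is "?L = ?A \<union> ?B")
proof (intro equalityI subsetI)
  \<comment> \<open>Entries are at least 2, so the truncated subtraction of 1 is undone by
    \<open>Suc\<close> and the results still lie in the range starting at 1.\<close>
  have shift: "js \<in> map Suc ` increasing_seqs l n"
    if "length js = l" "sorted_wrt (<) js" "set js \<subseteq> {2..Suc n}" for js :: "nat list" and l
  proof (rule image_eqI)
    have *: "map Suc (map (\<lambda>j. j - 1) js) = js"
      using that(3) by (force intro!: map_idI)
    then show "js = map Suc (map (\<lambda>j. j - 1) js)" by simp
    have "sorted_wrt (<) (map (\<lambda>j. j - 1) js)"
      using that(2) unfolding sorted_wrt_map
      by (rule sorted_wrt_mono_rel[rotated]) (use that(3) in force)
    then show "map (\<lambda>j. j - 1) js \<in> increasing_seqs l n"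
      using that by (force simp: increasing_seqs_def)
  qed
  fix js assume js: "js \<in> ?L"
  show "js \<in> ?A \<union> ?B"
  proof (cases "1 \<in> set js")
    case False
    then have "set js \<subseteq> {2..Suc n}" using js
      by (force simp: increasing_seqs_def subset_iff le_less eval_nat_numeral Suc_le_eq)
    then have "js \<in> map Suc ` increasing_seqs k n"
      using js by (intro shift) (auto simp: increasing_seqs_def)
    then show ?thesis by simp
  next
    case True
    then obtain j js' where j: "js = j # js'" by (cases js) auto
    with js True have "j = 1" by (force simp: increasing_seqs_def)
    with js j have "set js' \<subseteq> {2..Suc n}" by (force simp: increasing_seqs_def)
    with js j have "js' \<in> map Suc ` increasing_seqs (length js') n"
      by (intro shift) (auto simp: increasing_seqs_def)
    moreover have "k = Suc (length js')" using js j by (simp add: increasing_seqs_def)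
    ultimately show ?thesis using j \<open>j = 1\<close> by auto
  qed
next
  fix js assume "js \<in> ?A \<union> ?B"
  then show "js \<in> ?L"
    by (force simp: increasing_seqs_def sorted_wrt_map split: nat.splits)
qed

lemma sum_increasing_seqs_Suc:
  "(\<Sum>js\<in>increasing_seqs k (Suc n). f js) = (\<Sum>js\<in>increasing_seqs k n. f (map Suc js)) +
     (case k of 0 \<Rightarrow> 0 | Suc k' \<Rightarrow> \<Sum>js\<in>increasing_seqs k' n. f (1 # map Suc js))"
proof -
  have "map Suc ` increasing_seqs k n \<inter>
      (case k of 0 \<Rightarrow> {} | Suc k' \<Rightarrow> (\<lambda>js. 1 # map Suc js) ` increasing_seqs k' n) = {}"
    by (auto simp: increasing_seqs_def split: nat.splits)
  then show ?thesis
    unfolding increasing_seqs_Suc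
    by (subst sum.union_disjoint)
      (auto simp: finite_increasing_seqs sum.reindex inj_on_def split: nat.splits)
qed

lemma place_0 [simp]: "place 0 js xs d = []"
  by (simp add: place_def)

lemma map_of_zip_map_Suc: "map_of (zip (map Suc js) xs) (Suc j) = map_of (zip js xs) j"
  by (induction js arbitrary: xs) (simp_all add: zip_Cons1 split: list.split)

text \<open>Undoing the shift sends position 1 to 0, while positions start at 1. Hence an avoided
  position 1 receives the default value.\<close>

lemma map_of_zip_increasing_seqs_0:
  assumes "js \<in> increasing_seqs k n"
  shows "map_of (zip js xs) 0 = None"
proof -
  have "0 \<notin> set js" using assms by (auto simp: increasing_seqs_def)
  then show ?thesis by (auto simp: map_of_eq_None_iff dest!: set_zip_leftD)
qed

lemma upt_Suc_Suc: "[1..<Suc (Suc n)] = 1 # map Suc [1..<Suc n]"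
  by (simp add: upt_conv_Cons map_Suc_upt del: upt_Suc)

lemma place_Suc_empty:
  "js \<in> increasing_seqs k n \<Longrightarrow> place (Suc n) (map Suc js) xs d = d # place n js xs d"
  unfolding place_def upt_Suc_Suc
  by (simp add: map_of_zip_map_Suc map_of_zip_increasing_seqs_0 comp_def del: upt_Suc)

lemma place_Suc_filled:
  "js \<in> increasing_seqs k n \<Longrightarrow> place (Suc n) (Suc 0 # map Suc js) (x # xs) d = x # place n js xs d"
  unfolding place_def upt_Suc_Suc
  by (simp add: map_of_zip_map_Suc comp_def del: upt_Suc cong: map_cong)

text \<open>Induction along \<open>increasing_seqs_Suc\<close> together with the list
  \<open>xs\<close> of fillers, which loses its head exactly when position 1 is used.\<close>

lemma increasing_seqs_induct [consumes 2, case_names zero empty filled]: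
  assumes "js \<in> increasing_seqs k n" "length xs = k"
    and "Q 0 [] []"
    and "\<And>k n js xs. js \<in> increasing_seqs k n \<Longrightarrow> length xs = k \<Longrightarrow> Q n js xs \<Longrightarrow> Q (Suc n) (map Suc js) xs"
    and "\<And>k n js x xs. js \<in> increasing_seqs k n \<Longrightarrow> length xs = k \<Longrightarrow> Q n js xs \<Longrightarrow>
      Q (Suc n) (Suc 0 # map Suc js) (x # xs)"
  shows "Q n js xs"
  using assms(1,2)
proof (induction n arbitrary: k js xs)
  case 0
  then show ?case using assms(3) by (auto simp: increasing_seqs_0 split: if_splits)
next
  case (Suc n)
  then show ?case using assms(4,5)
    by (force simp: increasing_seqs_Suc length_Suc_conv split: nat.splits)
qed

lemma length_place [simp]: "length (place n js xs d) = n"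
  by (simp add: place_def)

text \<open>Each filled position trades its default arity 1 for an entry of \<open>ks\<close>.
  Stating this with \<open>k\<close> added on the left avoids truncated subtraction.\<close>

lemma sum_list_place:
  assumes "js \<in> increasing_seqs k n" "length ks = k"
  shows "sum_list (place n js ks 1) + k = n + sum_list ks"
proof -
  have "sum_list (place n js ks 1) + length ks = n + sum_list ks"
    using assms by (induction rule: increasing_seqs_induct)
      (simp_all add: place_Suc_empty place_Suc_filled)
  then show ?thesis using assms(2) by simp
qed

text \<open>Every filler is really placed, so a zero argument yields a zero input of the
  composition.\<close>

lemma set_subset_place:
  assumes "js \<in> increasing_seqs k n" "length xs = k"
  shows "set xs \<subseteq> set (place n js xs d)"
  using assms by (induction rule: increasing_seqs_induct)
    (auto simp: place_Suc_empty place_Suc_filled)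

lemma list_all2_place:
  assumes "js \<in> increasing_seqs k n" "length xs = k" "list_all2 R xs ys" "R d e"
  shows "list_all2 R (place n js xs d) (place n js ys e)"
  using assms by (induction arbitrary: ys rule: increasing_seqs_induct)
    (auto simp: place_Suc_empty place_Suc_filled list_all2_Cons1)

context
  fixes e :: "nat \<Rightarrow>\<^sub>0 'v::ab_group_add" and i :: 'v
  assumes e: "e = Poly_Mapping.single (Suc 0) i" and i: "i \<noteq> 0"
begin

text \<open>Choosing increasing positions for the letters of \<open>ws\<close> amounts to factoring
  \<open>ws\<close> into \<open>n\<close> words of length at most 1. Empty words give
  \<open>e\<close>, whose only key is 1 because \<open>i\<close> is nonzero; longer words give 0,
  which has no keys and contributes nothing.\<close>

lemma sum_place_eq_sum_slot:
  fixes ws :: "(nat \<Rightarrow>\<^sub>0 'v) list" and g :: "nat list \<Rightarrow> 'v list \<Rightarrow> 'b::comm_monoid_add"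
  shows "(\<Sum>ks\<in>listset (map Poly_Mapping.keys ws). \<Sum>js\<in>increasing_seqs (length ws) n.
      g (place n js ks 1) (place n js (map2 Poly_Mapping.lookup ws ks) i)) =
    (\<Sum>bss\<in>factorizations n ws. \<Sum>ks\<in>listset (map (\<lambda>b. Poly_Mapping.keys (slot e b)) bss).
      g ks (map2 Poly_Mapping.lookup (map (slot e) bss) ks))"
proof (induction n arbitrary: ws g)
  case 0
  then show ?case by (cases ws) (simp_all add: increasing_seqs_0 factorizations_0)
next
  case (Suc n)
  let ?F = "\<lambda>zs. \<Sum>ks\<in>listset (map Poly_Mapping.keys zs). g ks (map2 Poly_Mapping.lookup zs ks)"
  have F0: "?F zs = 0" if "0 \<in> set zs" for zs
  proof -
    have "listset (map Poly_Mapping.keys zs) = {}"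
      using that by (force simp: in_listset_iff list_all2_conv_all_nth in_set_conv_nth)
    then show ?thesis by simp
  qed
  show ?case
  proof (cases ws)
    case Nil
    then show ?thesis
      using sum_slot_Suc[where F = ?F and n = n and w = "[]" and e = e, OF F0] Suc[where g = "\<lambda>ks qs. g (1 # ks) (i # qs)" and ws = "[]"] i
      by (simp add: sum_increasing_seqs_Suc place_Suc_empty sum_listset_Cons comp_def e
          del: listset.simps(2))
  next
    case (Cons w ws')
    \<comment> \<open>Position 1 is avoided: arity 1 and the element \<open>i\<close> are prepended,
      as for an empty first slot.\<close>
    have 1: "(\<Sum>ks\<in>listset (map Poly_Mapping.keys ws). \<Sum>js\<in>increasing_seqs (length ws) n.
      g (place (Suc n) (map Suc js) ks 1) (place (Suc n) (map Suc js) (map2 Poly_Mapping.lookup ws ks) i)) =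
      (\<Sum>bss\<in>factorizations n ws. ?F (e # map (slot e) bss))"
      using Suc[where g = "\<lambda>ks qs. g (1 # ks) (i # qs)" and ws = ws] i
      by (simp add: place_Suc_empty sum_listset_Cons comp_def e del: listset.simps(2))
    \<comment> \<open>Position 1 is used: it receives a component of the first letter
      \<open>w\<close>, and \<open>ws'\<close> remains for the other positions.\<close>
    have 2: "(\<Sum>ks\<in>listset (map Poly_Mapping.keys ws). \<Sum>js\<in>increasing_seqs (length ws') n.
      g (place (Suc n) (1 # map Suc js) ks 1) (place (Suc n) (1 # map Suc js) (map2 Poly_Mapping.lookup ws ks) i)) =
      (\<Sum>bss\<in>factorizations n ws'. ?F (w # map (slot e) bss))"
      using Suc[where g = "\<lambda>ks qs. g (k # ks) (Poly_Mapping.lookup w k # qs)" and ws = ws' for k]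
      by (simp add: Cons place_Suc_filled sum_listset_Cons comp_def
          sum.swap[of _ _ "factorizations n ws'"] del: listset.simps(2))
    show ?thesis
      using sum_slot_Suc[where F = ?F and n = n and w = ws and e = e, OF F0] 1 2 
      by (simp add: sum_increasing_seqs_Suc sum.distrib comp_def Cons del: listset.simps(2))
  qed
qed

end

section \<open>The brace algebra of an operad\<close>

lemma sum_list_concat: "sum_list (concat xss) = sum_list (map sum_list xss)"
  by (induction xss) simp_all

lemma sum_single_lookup:
  "(\<Sum>k\<in>Poly_Mapping.keys x. Poly_Mapping.single k (Poly_Mapping.lookup x k)) = x"
proof (rule poly_mapping_eqI)
  fix j
  show "Poly_Mapping.lookup (\<Sum>k\<in>Poly_Mapping.keys x. Poly_Mapping.single k (Poly_Mapping.lookup x k)) j =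
      Poly_Mapping.lookup x j"
    by (simp add: lookup_sum lookup_single when_def in_keys_iff)
qed

lemma single_eq_0_iff: "Poly_Mapping.single k q = 0 \<longleftrightarrow> q = 0"
  by (metis lookup_single_eq lookup_zero single_zero)

context nonsigma_operad
begin

interpretation DS: vector_space "direct_sum_scale scale :: 'k \<Rightarrow> (nat \<Rightarrow>\<^sub>0 'v) \<Rightarrow> _"
  by (rule vector_space_direct_sum_scale)

text \<open>The summand of arity 0 is included here; \<open>direct_sum_positive\<close> identifies
  this space with the sum over arities at least 1 when \<open>P 0 = {0}\<close>.\<close>

abbreviation (input) "V \<equiv> direct_sum UNIV P"

lemma in_direct_sum_iff: "x \<in> V \<longleftrightarrow> (\<forall>n. Poly_Mapping.lookup x n \<in> P n)"
  by (simp add: direct_sum_def)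

lemma zero_in_P [simp]: "0 \<in> P n"
  by (rule subspace_0[OF subspace_P])

lemma subspace_direct_sum: "DS.subspace V"
  by (auto simp: DS.subspace_def in_direct_sum_iff lookup_add lookup_direct_sum_scale
      subspace_add[OF subspace_P] subspace_scale[OF subspace_P])

lemma single_in_direct_sum [simp]: "q \<in> P n \<Longrightarrow> Poly_Mapping.single n q \<in> V"
  by (simp add: in_direct_sum_iff lookup_single when_def)

lemma direct_sum_scale_single:
  "direct_sum_scale scale c (Poly_Mapping.single n q) = Poly_Mapping.single n (scale c q)"
  by (rule poly_mapping_eqI) (simp add: lookup_single when_def lookup_direct_sum_scale)

text \<open>Cancellation can make the support of \<open>x + y\<close> smaller than the union of the
  supports. All three sums are extended to that union, where the extra terms vanish by additivity of
  \<open>\<phi>\<close>.\<close>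

lemma sum_keys_add:
  fixes \<phi> :: "nat \<Rightarrow> 'v \<Rightarrow> 'c::ab_group_add"
  assumes add: "\<And>k q r. q \<in> P k \<Longrightarrow> r \<in> P k \<Longrightarrow> \<phi> k (q + r) = \<phi> k q + \<phi> k r"
    and "x \<in> V" "y \<in> V"
  shows "(\<Sum>k\<in>Poly_Mapping.keys (x + y). \<phi> k (Poly_Mapping.lookup (x + y) k)) =
    (\<Sum>k\<in>Poly_Mapping.keys x. \<phi> k (Poly_Mapping.lookup x k)) +
    (\<Sum>k\<in>Poly_Mapping.keys y. \<phi> k (Poly_Mapping.lookup y k))"
proof -
  let ?K = "Poly_Mapping.keys x \<union> Poly_Mapping.keys y"
  have \<phi>0: "\<phi> k 0 = 0" for k using add[of 0 k 0] by simp
  have ext: "(\<Sum>k\<in>Poly_Mapping.keys z. \<phi> k (Poly_Mapping.lookup z k)) = (\<Sum>k\<in>?K. \<phi> k (Poly_Mapping.lookup z k))"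
    if "Poly_Mapping.keys z \<subseteq> ?K" for z
    using that by (intro sum.mono_neutral_left) (auto simp: in_keys_iff \<phi>0)
  show ?thesis
    unfolding ext[OF keys_add] ext[OF Un_upper1] ext[OF Un_upper2]
    using assms(2,3) by (simp add: lookup_add add in_direct_sum_iff sum.distrib)
qed

lemma sum_keys_scale:
  assumes scl: "\<And>k q. q \<in> P k \<Longrightarrow> \<phi> k (scale c q) = direct_sum_scale scale c (\<phi> k q)"
    and \<phi>0: "\<And>k. \<phi> k 0 = 0"
    and "x \<in> V"
  shows "(\<Sum>k\<in>Poly_Mapping.keys (direct_sum_scale scale c x). \<phi> k (Poly_Mapping.lookup (direct_sum_scale scale c x) k)) =
    direct_sum_scale scale c (\<Sum>k\<in>Poly_Mapping.keys x. \<phi> k (Poly_Mapping.lookup x k))"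
proof -
  have "(\<Sum>k\<in>Poly_Mapping.keys (direct_sum_scale scale c x). \<phi> k (Poly_Mapping.lookup (direct_sum_scale scale c x) k)) =
    (\<Sum>k\<in>Poly_Mapping.keys x. \<phi> k (Poly_Mapping.lookup (direct_sum_scale scale c x) k))"
    by (rule sum.mono_neutral_left) (auto simp: in_keys_iff lookup_direct_sum_scale \<phi>0)
  then show ?thesis using assms(3) by (simp add: scl in_direct_sum_iff lookup_direct_sum_scale DS.scale_sum_right)
qed

text \<open>One multilinear map \<open>G ks\<close> for each list of arities extends to the direct
  sum componentwise, the value of \<open>G ks\<close> landing in the summand \<open>s ks\<close>.
  Both \<open>G\<close> and \<open>s\<close> vary in the induction, since the first arity is
  absorbed into them.\<close>

lemma multilinear_on_extension:
  assumes "\<And>ks. length ks = n \<Longrightarrow> multilinear_on (map P ks) (G ks)"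
  shows "DS.multilinear_on (replicate n V) (\<lambda>zs. \<Sum>ks\<in>listset (map Poly_Mapping.keys zs).
    Poly_Mapping.single (s ks) (G ks (map2 Poly_Mapping.lookup zs ks)))"
  using assms
proof (induction n arbitrary: G s)
  case (Suc n)
  have G: "G (k # ks) ((q + r) # qs) = G (k # ks) (q # qs) + G (k # ks) (r # qs)"
      "G (k # ks) (scale c q # qs) = scale c (G (k # ks) (q # qs))"
    if "length ks = n" "q \<in> P k" "r \<in> P k" "list_all2 (\<in>) qs (map P ks)" for k ks q r qs c
    using Suc.prems[of "k # ks"] that by (auto simp: multilinear_on_Cons[OF subspace_P])
  have G': "multilinear_on (map P ks) (\<lambda>qs. G (k # ks) (q # qs))"
    if "length ks = n" "q \<in> P k" for k ks q
    using Suc.prems[of "k # ks"] that by (auto simp: multilinear_on_Cons[OF subspace_P])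
  have mem: "list_all2 (\<in>) (map2 Poly_Mapping.lookup zs ks) (map P ks)" "length ks = n"
    if "list_all2 (\<in>) zs (replicate n V)" "ks \<in> listset (map Poly_Mapping.keys zs)" for zs ks
    using that by (auto simp: list_all2_conv_all_nth in_listset_iff in_direct_sum_iff)
  \<comment> \<open>The contribution of a component \<open>q\<close> of arity \<open>k\<close> of
    the first argument, with the other arguments fixed.\<close>
  define \<phi> where "\<phi> zs k q = (\<Sum>ks\<in>listset (map Poly_Mapping.keys zs).
    Poly_Mapping.single (s (k # ks)) (G (k # ks) (q # map2 Poly_Mapping.lookup zs ks)))" for zs k q
  have \<phi>_add: "\<phi> zs k (q + r) = \<phi> zs k q + \<phi> zs k r"
    if "list_all2 (\<in>) zs (replicate n V)" "q \<in> P k" "r \<in> P k" for zs k q r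
    using that mem[OF that(1)] by (simp add: \<phi>_def G single_add sum.distrib)
  have \<phi>_scale: "\<phi> zs k (scale c q) = direct_sum_scale scale c (\<phi> zs k q)"
    if "list_all2 (\<in>) zs (replicate n V)" "q \<in> P k" for zs k q c
    using that mem[OF that(1)]
    by (simp add: \<phi>_def G DS.scale_sum_right direct_sum_scale_single)
  have \<phi>_0: "\<phi> zs k 0 = 0" if "list_all2 (\<in>) zs (replicate n V)" for zs k
    using \<phi>_add[OF that, of 0 k 0] by simp
  have \<phi>_ml: "DS.multilinear_on (replicate n V) (\<lambda>zs. \<phi> zs k q)" if "q \<in> P k" for k q
    unfolding \<phi>_def using that by (intro Suc.IH[where s = "\<lambda>ks. s (k # ks)"] G')
  show ?case
    by (simp add: sum_listset_Cons DS.multilinear_on_Cons[OF subspace_direct_sum] flip: \<phi>_def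
          del: listset.simps(2))
      (auto simp: sum_keys_add \<phi>_add sum_keys_scale \<phi>_scale \<phi>_0 in_direct_sum_iff
          intro!: DS.multilinear_on_sum \<phi>_ml)
qed simp

section \<open>Operadic composition extended multilinearly to the direct sum\<close>

definition full_comp :: "'v \<Rightarrow> (nat \<Rightarrow>\<^sub>0 'v) list \<Rightarrow> (nat \<Rightarrow>\<^sub>0 'v)" where
  "full_comp p zs = (\<Sum>ks\<in>listset (map Poly_Mapping.keys zs).
     Poly_Mapping.single (sum_list ks) (\<gamma> ks p (map2 Poly_Mapping.lookup zs ks)))"

lemma comp_multilinear_args: "p \<in> P (length ks) \<Longrightarrow> multilinear_on (map P ks) (\<gamma> ks p)"
  using comp_multilinear[of ks] by (simp add: multilinear_on_Cons[OF subspace_P])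

lemma comp_linear:
  assumes "p \<in> P (length ks)" "list_all2 (\<in>) qs (map P ks)"
  shows "q \<in> P (length ks) \<Longrightarrow> \<gamma> ks (p + q) qs = \<gamma> ks p qs + \<gamma> ks q qs"
    and "\<gamma> ks (scale c p) qs = scale c (\<gamma> ks p qs)"
  using comp_multilinear[of ks] assms by (auto simp: multilinear_on_Cons[OF subspace_P])

lemma full_comp_multilinear:
  "p \<in> P n \<Longrightarrow> DS.multilinear_on (replicate n V) (full_comp p)"
  unfolding full_comp_def by (rule multilinear_on_extension) (simp add: comp_multilinear_args)

lemma lookups_in_P:
  assumes "set zs \<subseteq> V" "ks \<in> listset (map Poly_Mapping.keys zs)"
  shows "list_all2 (\<in>) (map2 Poly_Mapping.lookup zs ks) (map P ks)" "length ks = length zs"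
  using assms by (auto simp: list_all2_conv_all_nth in_listset_iff in_direct_sum_iff subset_iff all_set_conv_all_nth)

lemma full_comp_linear:
  assumes "set zs \<subseteq> V" "p \<in> P (length zs)"
  shows "q \<in> P (length zs) \<Longrightarrow> full_comp (p + q) zs = full_comp p zs + full_comp q zs"
    and "full_comp (scale c p) zs = direct_sum_scale scale c (full_comp p zs)"
  using assms(2) lookups_in_P[OF assms(1)]
  by (simp_all add: full_comp_def comp_linear single_add sum.distrib DS.scale_sum_right direct_sum_scale_single)

lemma full_comp_zero: "0 \<in> set zs \<Longrightarrow> full_comp p zs = 0"
proof -
  assume "0 \<in> set zs"
  then have "listset (map Poly_Mapping.keys zs) = {}"
    by (force simp: in_listset_iff list_all2_conv_all_nth in_set_conv_nth)
  then show ?thesis by (simp add: full_comp_def)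
qed

lemma full_comp_closed:
  assumes "set zs \<subseteq> V" "p \<in> P (length zs)"
  shows "full_comp p zs \<in> V"
  unfolding full_comp_def
  using assms(2) lookups_in_P[OF assms(1)]
  by (auto intro!: DS.subspace_sum[OF subspace_direct_sum] single_in_direct_sum comp_closed)

text \<open>A nonzero homogeneous element has exactly one key, but \<open>single m 0\<close> has
  none. Zero entries are therefore treated separately wherever homogeneous arguments are
  substituted.\<close>

lemma singles_nonzero:
  assumes "list_all2 (\<in>) rs (map P ms)" "0 \<notin> set rs"
  shows "listset (map Poly_Mapping.keys (map2 Poly_Mapping.single ms rs)) = {ms}"
    and "map2 Poly_Mapping.lookup (map2 Poly_Mapping.single ms rs) ms = rs"
  using assms by (induction ms arbitrary: rs) (auto simp: list_all2_Cons2 set_Cons_def)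

lemma zero_in_singles:
  fixes rs :: "'v list"
  assumes "length rs = length ms" "0 \<in> set rs"
  shows "0 \<in> set (map2 Poly_Mapping.single ms rs)"
proof -
  obtain j where "j < length rs" "rs ! j = 0" using assms(2) by (auto simp: in_set_conv_nth)
  then show ?thesis using assms(1) by (force simp: in_set_conv_nth)
qed

lemma full_comp_singles:
  assumes "list_all2 (\<in>) rs (map P ms)" "p \<in> P (length ms)"
  shows "full_comp p (map2 Poly_Mapping.single ms rs) = Poly_Mapping.single (sum_list ms) (\<gamma> ms p rs)"
proof (cases "0 \<in> set rs")
  case True
  then have "0 \<in> set (map2 Poly_Mapping.single ms rs)"
    using list_all2_lengthD[OF assms(1)] by (intro zero_in_singles) simp_all
  moreover have "\<gamma> ms p rs = 0"
    by (rule multilinear_on_zero[OF comp_multilinear_args assms(1)]) (use assms True in auto)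
  ultimately show ?thesis by (simp add: full_comp_zero)
next
  case False
  then show ?thesis using singles_nonzero[OF assms(1)] by (simp add: full_comp_def)
qed

text \<open>The inner compositions are expanded into components, and \<open>comp_assoc\<close> is
  applied for each choice \<open>lss\<close> of arities. \<open>sum_listset_concat\<close> then
  flattens the sum over \<open>lss\<close> into one over the arities of all inner arguments.\<close>

lemma full_comp_assoc:
  assumes p: "p \<in> P (length zss)" and qs: "list_all2 (\<lambda>q zs. q \<in> P (length zs)) qs zss"
    and zss: "\<And>zs. zs \<in> set zss \<Longrightarrow> set zs \<subseteq> V"
  shows "full_comp (\<gamma> (map length zss) p qs) (concat zss) = full_comp p (map2 full_comp qs zss)"
proof -
  let ?h = "\<lambda>(q, zs) ls. Poly_Mapping.single (sum_list ls) (\<gamma> ls q (map2 Poly_Mapping.lookup zs ls))"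
  let ?A = "\<lambda>(q, zs). listset (map Poly_Mapping.keys zs)"
  let ?as = "zip qs zss"
  have len: "length qs = length zss" using qs by (rule list_all2_lengthD)
  have q: "q \<in> P (length zs)" "set zs \<subseteq> V" if "(q, zs) \<in> set ?as" for q zs
    using that qs zss by (auto simp: list_all2_iff dest: set_zip_rightD)
  have "full_comp p (map2 full_comp qs zss) = full_comp p (map (\<lambda>a. \<Sum>ls\<in>?A a. ?h a ls) ?as)"
    by (rule arg_cong[where f = "full_comp p"]) (auto simp: full_comp_def)
  also have "\<dots> = (\<Sum>lss\<in>listset (map ?A ?as). full_comp p (map2 ?h ?as lss))"
  proof (rule DS.multilinear_on_expand[where W = "\<lambda>_. V"])
    show "DS.multilinear_on (map (\<lambda>_. V) ?as) (full_comp p)"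
      using full_comp_multilinear[OF p] len by (simp add: map_replicate_const)
    show "?h a ls \<in> V" if "a \<in> set ?as" "ls \<in> ?A a" for a ls
    proof -
      obtain q zs where a: "a = (q, zs)" by (cases a)
      show ?thesis using that q[of q zs] lookups_in_P[of zs ls]
        by (simp add: a comp_closed)
    qed
  qed (rule subspace_direct_sum)
  also have "map ?A ?as = map (\<lambda>zs. listset (map Poly_Mapping.keys zs)) zss"
    using len by (auto intro!: nth_equalityI)
  also have "(\<Sum>lss\<in>listset \<dots>. full_comp p (map2 ?h ?as lss)) =
    (\<Sum>lss\<in>listset \<dots>. Poly_Mapping.single (sum_list (concat lss))
      (\<gamma> (concat lss) (\<gamma> (map length zss) p qs) (map2 Poly_Mapping.lookup (concat zss) (concat lss))))"
  proof (rule sum.cong[OF refl])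
    fix lss assume "lss \<in> listset (map (\<lambda>zs. listset (map Poly_Mapping.keys zs)) zss)"
    then have lss: "list_all2 (\<lambda>ls zs. ls \<in> listset (map Poly_Mapping.keys zs)) lss zss"
      by (simp add: in_listset_iff list_all2_map2)
    then have len2: "length lss = length zss" by (rule list_all2_lengthD)
    have each: "list_all2 (\<in>) (map2 Poly_Mapping.lookup (zss ! i) (lss ! i)) (map P (lss ! i))"
      "length (lss ! i) = length (zss ! i)" "qs ! i \<in> P (length (zss ! i))" if "i < length zss" for i
      using that lss qs zss lookups_in_P[of "zss ! i" "lss ! i"]
      by (auto simp: list_all2_conv_all_nth)
    \<comment> \<open>The arities of the inner operations count their arguments, so the composite of
      \<open>p\<close> and \<open>qs\<close> is the same for every \<open>lss\<close>.\<close>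
    have lens: "map length lss = map length zss"
      using each(2) len2 by (auto intro: nth_equalityI)
    let ?rss = "map2 (map2 Poly_Mapping.lookup) zss lss"
    let ?qs = "map (\<lambda>i. \<gamma> (lss ! i) (qs ! i) (?rss ! i)) [0..<length lss]"
    have "map2 ?h ?as lss = map2 Poly_Mapping.single (map sum_list lss) ?qs"
      using len len2 by (auto intro!: nth_equalityI)
    moreover have "full_comp p \<dots> =
        Poly_Mapping.single (sum_list (map sum_list lss)) (\<gamma> (map sum_list lss) p ?qs)"
      using p len2 each
      by (intro full_comp_singles) (auto simp: list_all2_conv_all_nth intro!: comp_closed)
    moreover have "\<gamma> (concat lss) (\<gamma> (map length lss) p qs) (concat ?rss) = \<gamma> (map sum_list lss) p ?qs"
      using p len len2 each
      by (intro comp_assoc) (auto simp: list_all2_conv_all_nth)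
    moreover have "concat ?rss = map2 Poly_Mapping.lookup (concat zss) (concat lss)"
      using lss
    proof (induction lss zss rule: list_all2_induct)
      case (Cons ls lss zs zss)
      then have "length ls = length zs" by (auto simp: in_listset_iff dest: list_all2_lengthD)
      with Cons show ?case by simp
    qed simp
    ultimately show "full_comp p (map2 ?h ?as lss) = Poly_Mapping.single (sum_list (concat lss))
      (\<gamma> (concat lss) (\<gamma> (map length zss) p qs) (map2 Poly_Mapping.lookup (concat zss) (concat lss)))"
      by (simp add: lens sum_list_concat)
  qed
  also have "\<dots> = full_comp (\<gamma> (map length zss) p qs) (concat zss)"
    using sum_listset_concat[of "\<lambda>ls. Poly_Mapping.single (sum_list ls)
      (\<gamma> ls (\<gamma> (map length zss) p qs) (map2 Poly_Mapping.lookup (concat zss) ls))"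
      "map (map Poly_Mapping.keys) zss"]
    by (simp add: full_comp_def map_concat comp_def)
  finally show ?thesis ..
qed

section \<open>The bracket in slot form\<close>

abbreviation (input) "one \<equiv> Poly_Mapping.single (Suc 0) I"

text \<open>The arity \<open>n\<close> is an explicit argument because \<open>p\<close> does not
  determine it: the spaces \<open>P n\<close> may overlap.\<close>

definition hom_bracket :: "nat \<Rightarrow> 'v \<Rightarrow> (nat \<Rightarrow>\<^sub>0 'v) list \<Rightarrow> (nat \<Rightarrow>\<^sub>0 'v)" where
  "hom_bracket n p ws = (\<Sum>bss\<in>factorizations n ws. full_comp p (map (slot one) bss))"

lemma one_in_direct_sum: "one \<in> V"
  by (simp add: unit_in[simplified])

lemma slot_in_direct_sum: "set b \<subseteq> V \<Longrightarrow> slot one b \<in> V"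
  using one_in_direct_sum DS.subspace_0[OF subspace_direct_sum] by (auto simp: slot_def split: list.split)

lemma slots_in_direct_sum:
  "set ws \<subseteq> V \<Longrightarrow> bss \<in> factorizations n ws \<Longrightarrow> set (map (slot one) bss) \<subseteq> V"
  using in_factorizations_set[of bss n ws] by (auto intro!: slot_in_direct_sum)

lemma hom_bracket_linear:
  assumes "set ws \<subseteq> V" "p \<in> P n"
  shows "q \<in> P n \<Longrightarrow> hom_bracket n (p + q) ws = hom_bracket n p ws + hom_bracket n q ws"
    and "hom_bracket n (scale c p) ws = direct_sum_scale scale c (hom_bracket n p ws)"
proof -
  have "set (map (slot one) bss) \<subseteq> V" "p \<in> P (length (map (slot one) bss))" "length bss = n"
    if "bss \<in> factorizations n ws" for bss
    using that assms slots_in_direct_sum by (auto simp: factorizations_def)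
  then show "q \<in> P n \<Longrightarrow> hom_bracket n (p + q) ws = hom_bracket n p ws + hom_bracket n q ws"
    and "hom_bracket n (scale c p) ws = direct_sum_scale scale c (hom_bracket n p ws)"
    by (simp_all add: hom_bracket_def full_comp_linear sum.distrib DS.scale_sum_right)
qed

lemma hom_bracket_0: "set ws \<subseteq> V \<Longrightarrow> hom_bracket n 0 ws = 0"
  using hom_bracket_linear(2)[of ws 0 n 0] by simp

lemma hom_bracket_closed: "set ws \<subseteq> V \<Longrightarrow> p \<in> P n \<Longrightarrow> hom_bracket n p ws \<in> V"
  unfolding hom_bracket_def
  by (intro DS.subspace_sum[OF subspace_direct_sum] full_comp_closed slots_in_direct_sum)
    (auto simp: factorizations_def)

lemma hom_bracket_multilinear:
  assumes "p \<in> P n"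
  shows "DS.multilinear_on (replicate k V) (hom_bracket n p)"
  unfolding hom_bracket_def
  by (rule DS.multilinear_on_slots[OF subspace_direct_sum one_in_direct_sum full_comp_multilinear[OF assms] full_comp_zero])

abbreviation (input) "br \<equiv> operad_bracket \<gamma> I"

text \<open>Every element equals its composite with the unit in front, so a zero unit forces
  everything to vanish. This settles the case excluded from
  \<open>sum_place_eq_sum_slot\<close>.\<close>

lemma trivial_if_unit_0:
  assumes "I = 0" "x \<in> V"
  shows "x = 0"
proof (rule poly_mapping_eqI)
  fix n
  have p: "Poly_Mapping.lookup x n \<in> P n" using assms(2) by (simp add: in_direct_sum_iff)
  then have "\<gamma> [n] (scale 0 I) [Poly_Mapping.lookup x n] = scale 0 (\<gamma> [n] I [Poly_Mapping.lookup x n])"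
    using unit_in by (intro comp_linear(2)) simp_all
  then show "Poly_Mapping.lookup x n = Poly_Mapping.lookup 0 n"
    using comp_unit_left[OF p] assms(1) by simp
qed

text \<open>The bridge from increasing positions to slots; after it, the bracket is handled through
  \<open>hom_bracket\<close>.\<close>

lemma operad_bracket_eq:
  assumes "x \<in> V"
  shows "br x ws = (\<Sum>n\<in>Poly_Mapping.keys x. hom_bracket n (Poly_Mapping.lookup x n) ws)"
proof (cases "I = 0")
  case True
  then show ?thesis using trivial_if_unit_0[OF _ assms] by (simp add: operad_bracket_def)
next
  case False
  show ?thesis
    unfolding operad_bracket_def hom_bracket_def full_comp_def partial_comp_def
  proof (rule sum.cong[OF refl])
    fix n
    show "(\<Sum>ks\<in>listset (map Poly_Mapping.keys ws). \<Sum>js\<in>increasing_seqs (length ws) n.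
        Poly_Mapping.single (sum_list (place n js ks 1))
          (\<gamma> (place n js ks 1) (Poly_Mapping.lookup x n) (place n js (map2 Poly_Mapping.lookup ws ks) I))) =
      (\<Sum>bss\<in>factorizations n ws. \<Sum>ks\<in>listset (map Poly_Mapping.keys (map (slot one) bss)).
        Poly_Mapping.single (sum_list ks)
          (\<gamma> ks (Poly_Mapping.lookup x n) (map2 Poly_Mapping.lookup (map (slot one) bss) ks)))"
      by (subst sum_place_eq_sum_slot[OF refl False, where g = "\<lambda>ks qs.
        Poly_Mapping.single (sum_list ks) (\<gamma> ks (Poly_Mapping.lookup x n) qs)"]) (simp add: comp_def)
  qed
qed

lemma operad_bracket_single:
  assumes "p \<in> P n" "set ws \<subseteq> V"
  shows "br (Poly_Mapping.single n p) ws = hom_bracket n p ws"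
  using assms by (simp add: operad_bracket_eq hom_bracket_0 keys_single)

lemma operad_bracket_multilinear:
  "DS.multilinear_on (replicate (Suc k) V) (\<lambda>xs. br (hd xs) (tl xs))"
proof -
  let ?f = "\<lambda>x ws. \<Sum>n\<in>Poly_Mapping.keys x. hom_bracket n (Poly_Mapping.lookup x n) ws"
  have sub: "set ws \<subseteq> V" if "list_all2 (\<in>) ws (replicate k V)" for ws
    using that by (auto simp: list_all2_conv_all_nth in_set_conv_nth)
  have "?f (x + y) ws = ?f x ws + ?f y ws" "?f (direct_sum_scale scale c x) ws = direct_sum_scale scale c (?f x ws)"
    if "x \<in> V" "y \<in> V" "list_all2 (\<in>) ws (replicate k V)" for x y ws c
    using that sub[OF that(3)]
    by (simp_all add: sum_keys_add[where \<phi> = "\<lambda>n q. hom_bracket n q ws"]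
        sum_keys_scale[where \<phi> = "\<lambda>n q. hom_bracket n q ws"] hom_bracket_linear hom_bracket_0)
  then have "DS.multilinear_on (replicate (Suc k) V) (\<lambda>xs. ?f (hd xs) (tl xs))"
    by (auto simp: DS.multilinear_on_Cons[OF subspace_direct_sum] in_direct_sum_iff
        intro!: DS.multilinear_on_sum hom_bracket_multilinear)
  then show ?thesis
    by (subst DS.multilinear_on_cong[where g = "\<lambda>xs. ?f (hd xs) (tl xs)"])
      (auto simp: operad_bracket_eq subspace_direct_sum list_all2_Cons2)
qed

lemma operad_bracket_sum:
  assumes "\<And>i. i \<in> A \<Longrightarrow> h i \<in> V" "set ws \<subseteq> V"
  shows "br (\<Sum>i\<in>A. h i) ws = (\<Sum>i\<in>A. br (h i) ws)"
  using DS.multilinear_on_sum_hd[OF subspace_direct_sum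
      operad_bracket_multilinear[of "length ws", unfolded replicate_Suc], of ws A h] assms
  by (auto simp: list_all2_conv_all_nth subset_iff)

lemma operad_bracket_closed: "x \<in> V \<Longrightarrow> set ws \<subseteq> V \<Longrightarrow> br x ws \<in> V"
  by (auto simp: operad_bracket_eq in_direct_sum_iff[of x]
      intro!: DS.subspace_sum[OF subspace_direct_sum] hom_bracket_closed)

lemma operad_bracket_0: "br 0 ws = 0"
  by (simp add: operad_bracket_def)

text \<open>The unit has a single input, which receives the whole word as one slot, and composing
  with the unit returns the content of that slot.\<close>

lemma operad_bracket_one:
  assumes "set w \<subseteq> V"
  shows "br one w = slot one w"
proof -
  have z: "slot one w \<in> V" by (rule slot_in_direct_sum[OF assms])
  have "br one w = full_comp I [slot one w]"
    using assms unit_in by (simp add: operad_bracket_single hom_bracket_def factorizations_1)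
  also have "\<dots> = (\<Sum>k\<in>Poly_Mapping.keys (slot one w). Poly_Mapping.single k (Poly_Mapping.lookup (slot one w) k))"
    using z by (simp add: full_comp_def sum_listset_Cons comp_unit_left in_direct_sum_iff del: listset.simps(2))
  finally show ?thesis by (simp add: sum_single_lookup)
qed

text \<open>The empty word factors only into empty words, so every input receives the unit.\<close>

lemma operad_bracket_Nil:
  assumes "x \<in> V"
  shows "br x [] = x"
proof -
  have "factorizations n [] = {replicate n ([] :: (nat \<Rightarrow>\<^sub>0 'v) list)}" for n
    by (auto simp: factorizations_def replicate_eqI)
  then have "hom_bracket n p [] = Poly_Mapping.single n p" if "p \<in> P n" for n p
    using full_comp_singles[of "replicate n I" "replicate n 1" p] that unit_in
    by (simp add: hom_bracket_def comp_unit_right[simplified] sum_list_replicate list_all2_conv_all_nth)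
  then show ?thesis using assms
    by (simp add: operad_bracket_eq in_direct_sum_iff sum_single_lookup)
qed

text \<open>Each letter of \<open>w\<close> is plugged into an input of exactly one of the \<open>rs\<close>, or into an empty
  slot, which is an input of the unit; operadic associativity regroups the letters accordingly.\<close>

lemma operad_bracket_full_comp:
  assumes p: "p \<in> P (length rs)" and rs: "set rs \<subseteq> V" and w: "set w \<subseteq> V"
  shows "br (full_comp p rs) w = (\<Sum>ws\<in>factorizations (length rs) w. full_comp p (map2 br rs ws))"
proof -
  let ?K = "listset (map Poly_Mapping.keys rs)"
  let ?H = "\<lambda>(q, k, u). hom_bracket k q u"
  \<comment> \<open>With the components of \<open>rs\<close> fixed,
    \<open>sum_factorizations_sum_list\<close> groups the slots of the composite by the entries of
    \<open>qs\<close>. Associativity and multilinearity turn each group into the bracket of one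
    entry.\<close>
  have step: "hom_bracket (sum_list ks) (\<gamma> ks p qs) w =
      (\<Sum>ws\<in>factorizations (length rs) w. full_comp p (map ?H (zip qs (zip ks ws))))"
    if len: "length ks = length rs" and qs: "list_all2 (\<in>) qs (map P ks)" for ks qs
  proof -
    have lenq: "length qs = length rs" using len list_all2_lengthD[OF qs] by simp
    have "(\<Sum>bss\<in>listset (map2 factorizations ks ws). full_comp (\<gamma> ks p qs) (map (slot one) (concat bss))) =
        full_comp p (map ?H (zip qs (zip ks ws)))" if ws: "ws \<in> factorizations (length rs) w" for ws
    proof -
      let ?as = "zip qs (zip ks ws)"
      let ?A = "\<lambda>(q, k, u). factorizations k u"
      let ?h = "\<lambda>(q, k, u) bs. full_comp q (map (slot one) bs)"
      have lenw: "length ws = length rs" using ws by (simp add: factorizations_def)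
      have as: "q \<in> P k" "set u \<subseteq> V" if "(q, k, u) \<in> set ?as" for q k u
      proof -
        from that obtain i where "i < length rs" "q = qs ! i" "k = ks ! i" "u = ws ! i"
          using lenq len lenw by (auto simp: set_zip)
        then show "q \<in> P k" "set u \<subseteq> V"
          using qs len in_factorizations_set[OF ws, of u] lenw w by (auto simp: list_all2_conv_all_nth)
      qed
      have "full_comp p (map ?H ?as) = full_comp p (map (\<lambda>a. \<Sum>bs\<in>?A a. ?h a bs) ?as)"
        by (rule arg_cong[where f = "full_comp p"]) (auto simp: hom_bracket_def)
      also have "\<dots> = (\<Sum>bss\<in>listset (map ?A ?as). full_comp p (map2 ?h ?as bss))"
      proof (rule DS.multilinear_on_expand[where W = "\<lambda>_. V"])
        show "DS.multilinear_on (map (\<lambda>_. V) ?as) (full_comp p)"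
          using full_comp_multilinear[OF p] len lenw lenq by (simp add: map_replicate_const)
        show "?h a bs \<in> V" if "a \<in> set ?as" "bs \<in> ?A a" for a bs
        proof -
          obtain q k u where a: "a = (q, k, u)" by (cases a)
          show ?thesis using that as[of q k u] slots_in_direct_sum[of u bs k]
            by (auto simp: a factorizations_def intro!: full_comp_closed)
        qed
      qed (rule subspace_direct_sum)
      also have "map ?A ?as = map2 factorizations ks ws"
        using len lenw lenq by (auto intro!: nth_equalityI)
      also have "(\<Sum>bss\<in>listset \<dots>. full_comp p (map2 ?h ?as bss)) =
          (\<Sum>bss\<in>listset \<dots>. full_comp (\<gamma> ks p qs) (map (slot one) (concat bss)))"
      proof (rule sum.cong[OF refl])
        fix bss assume "bss \<in> listset (map2 factorizations ks ws)"
        then have bss: "length bss = length rs" "\<And>i. i < length rs \<Longrightarrow> bss ! i \<in> factorizations (ks ! i) (ws ! i)"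
          using len lenw by (auto simp: in_listset_iff list_all2_conv_all_nth)
        let ?zss = "map (map (slot one)) bss"
        have lens: "map length ?zss = ks"
          using bss len by (auto intro!: nth_equalityI simp: factorizations_def)
        have "full_comp (\<gamma> (map length ?zss) p qs) (concat ?zss) = full_comp p (map2 full_comp qs ?zss)"
        proof (rule full_comp_assoc)
          show "p \<in> P (length ?zss)" using p bss by simp
          have "length (bss ! i) = ks ! i" if "i < length rs" for i
            using bss(2)[OF that] by (simp add: factorizations_def)
          then show "list_all2 (\<lambda>q zs. q \<in> P (length zs)) qs ?zss"
            using qs bss len lenq by (simp add: list_all2_conv_all_nth)
          fix zs assume "zs \<in> set ?zss"
          then obtain i where i: "i < length rs" "zs = map (slot one) (bss ! i)"
            using bss(1) by (auto simp: in_set_conv_nth)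
          show "set zs \<subseteq> V"
            unfolding i(2) using bss(2)[OF i(1)] 
            by (rule slots_in_direct_sum[rotated]) (use in_factorizations_set[OF ws, of "ws ! i"] lenw i w in auto)
        qed
        moreover have "map2 ?h ?as bss = map2 full_comp qs ?zss"
          using len lenw lenq bss(1) by (auto intro!: nth_equalityI)
        ultimately show "full_comp p (map2 ?h ?as bss) = full_comp (\<gamma> ks p qs) (map (slot one) (concat bss))"
          by (simp only: lens map_concat)
      qed
      finally show ?thesis ..
    qed
    then show ?thesis
      by (simp add: hom_bracket_def sum_factorizations_sum_list len)
  qed
  have qs: "list_all2 (\<in>) (map2 Poly_Mapping.lookup rs ks) (map P ks)" "length ks = length rs"
    "\<gamma> ks p (map2 Poly_Mapping.lookup rs ks) \<in> P (sum_list ks)" if "ks \<in> ?K" for ks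
    using lookups_in_P[OF rs that] p by (auto intro: comp_closed)
  have "br (full_comp p rs) w =
      (\<Sum>ks\<in>?K. hom_bracket (sum_list ks) (\<gamma> ks p (map2 Poly_Mapping.lookup rs ks)) w)"
    unfolding full_comp_def using qs w by (simp add: operad_bracket_sum operad_bracket_single)
  also have "\<dots> = (\<Sum>ks\<in>?K. \<Sum>ws\<in>factorizations (length rs) w.
      full_comp p (map ?H (zip (map2 Poly_Mapping.lookup rs ks) (zip ks ws))))"
    using qs by (intro sum.cong refl step) auto
  also have "\<dots> = (\<Sum>ws\<in>factorizations (length rs) w. \<Sum>ks\<in>?K.
      full_comp p (map ?H (zip (map2 Poly_Mapping.lookup rs ks) (zip ks ws))))"
    by (rule sum.swap)
  \<comment> \<open>Summing over \<open>ks\<close> reassembles each element of \<open>rs\<close>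
    from its components, again by multilinearity.\<close>
  also have "\<dots> = (\<Sum>ws\<in>factorizations (length rs) w. full_comp p (map2 br rs ws))"
  proof (rule sum.cong[OF refl])
    fix ws assume ws: "ws \<in> factorizations (length rs) w"
    let ?as = "zip rs ws"
    let ?A = "\<lambda>(r, u). Poly_Mapping.keys r"
    let ?h = "\<lambda>(r, u) k. hom_bracket k (Poly_Mapping.lookup r k) u"
    have lenw: "length ws = length rs" using ws by (simp add: factorizations_def)
    have as: "r \<in> V" "set u \<subseteq> V" if "(r, u) \<in> set ?as" for r u
      using set_zip_leftD[OF that] set_zip_rightD[OF that] rs w in_factorizations_set[OF ws, of u] by auto
    have "full_comp p (map2 br rs ws) = full_comp p (map (\<lambda>a. \<Sum>k\<in>?A a. ?h a k) ?as)"
      by (rule arg_cong[where f = "full_comp p"]) (auto simp: operad_bracket_eq as)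
    also have "\<dots> = (\<Sum>ks\<in>listset (map ?A ?as). full_comp p (map2 ?h ?as ks))"
    proof (rule DS.multilinear_on_expand[where W = "\<lambda>_. V"])
      show "DS.multilinear_on (map (\<lambda>_. V) ?as) (full_comp p)"
        using full_comp_multilinear[OF p] lenw by (simp add: map_replicate_const)
      show "?h a k \<in> V" if "a \<in> set ?as" for a k
      proof -
        obtain r u where a: "a = (r, u)" by (cases a)
        show ?thesis using as[of r u] that by (simp add: a in_direct_sum_iff[of r] hom_bracket_closed)
      qed
    qed (rule subspace_direct_sum)
    also have "map ?A ?as = map Poly_Mapping.keys rs"
      using lenw by (auto intro!: nth_equalityI)
    also have "(\<Sum>ks\<in>?K. full_comp p (map2 ?h ?as ks)) =
        (\<Sum>ks\<in>?K. full_comp p (map ?H (zip (map2 Poly_Mapping.lookup rs ks) (zip ks ws))))"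
      using qs(2) lenw by (intro sum.cong refl arg_cong[where f = "full_comp p"]) (auto intro!: nth_equalityI)
    finally show "(\<Sum>ks\<in>?K. full_comp p (map ?H (zip (map2 Poly_Mapping.lookup rs ks) (zip ks ws)))) =
      full_comp p (map2 br rs ws)" ..
  qed
  finally show ?thesis .
qed

lemma operad_bracket_bracket:
  assumes x: "x \<in> V" and ys: "set ys \<subseteq> V" and w: "set w \<subseteq> V"
  shows "br (br x ys) w = (\<Sum>ws\<in>factorizations (2 * length ys + 1) w. br x (inserted br ys ws))"
proof -
  let ?p = "Poly_Mapping.lookup x"
  have p: "?p n \<in> P n" for n using x by (simp add: in_direct_sum_iff)
  have "br (br x ys) w = (\<Sum>n\<in>Poly_Mapping.keys x. br (hom_bracket n (?p n) ys) w)"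
    by (simp add: operad_bracket_eq[OF x] operad_bracket_sum hom_bracket_closed ys w p)
  also have "\<dots> = (\<Sum>n\<in>Poly_Mapping.keys x. \<Sum>bss\<in>factorizations n ys.
      br (full_comp (?p n) (map (slot one) bss)) w)"
    unfolding hom_bracket_def
    by (intro sum.cong refl operad_bracket_sum w full_comp_closed slots_in_direct_sum[OF ys])
      (auto simp: factorizations_def p)
  also have "\<dots> = (\<Sum>n\<in>Poly_Mapping.keys x. \<Sum>bss\<in>factorizations n ys. \<Sum>ws\<in>factorizations n w.
      full_comp (?p n) (map2 (\<lambda>b u. br (slot one b) u) bss ws))"
  proof (intro sum.cong refl)
    fix n bss assume bss: "bss \<in> factorizations n ys"
    then have n: "length bss = n" by (simp add: factorizations_def)
    show "br (full_comp (?p n) (map (slot one) bss)) w = (\<Sum>ws\<in>factorizations n w.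
      full_comp (?p n) (map2 (\<lambda>b u. br (slot one b) u) bss ws))"
      using operad_bracket_full_comp[of "?p n" "map (slot one) bss" w] slots_in_direct_sum[OF ys bss] w n p
      by (simp add: zip_map1 comp_def split_def)
  qed
  \<comment> \<open>The reindexing lemma is used with the bracket as \<open>g\<close> and the unit
    as \<open>e\<close>. It needs that \<open>full_comp\<close> vanishes at a zero argument, that
    the bracket of 0 is 0, and \<open>operad_bracket_one\<close>.\<close>
  also have "\<dots> = (\<Sum>n\<in>Poly_Mapping.keys x. \<Sum>ws\<in>factorizations (2 * length ys + 1) w.
      hom_bracket n (?p n) (inserted br ys ws))"
    unfolding hom_bracket_def
    by (intro sum.cong refl sum_slot_inserted[where S = V])
      (simp_all add: full_comp_zero operad_bracket_0 operad_bracket_one w)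
  also have "\<dots> = (\<Sum>ws\<in>factorizations (2 * length ys + 1) w. br x (inserted br ys ws))"
    unfolding operad_bracket_eq[OF x] by (rule sum.swap)
  finally show ?thesis .
qed

lemma brace_algebra_direct_sum: "brace_algebra (direct_sum_scale scale) V br"
  by unfold_locales
    (simp_all del: replicate_Suc add: subspace_direct_sum operad_bracket_closed operad_bracket_multilinear operad_bracket_Nil
      operad_bracket_bracket factorizations_def inserted_def)

text \<open>If \<open>p\<close> and all entries of \<open>qs\<close> are nonzero, the sums over
  components have one term each. If one of them is zero, the left side is an empty sum, and each
  term on the right vanishes by multilinearity of the composition.\<close>

lemma operad_bracket_homogeneous:
  assumes p: "p \<in> P n" and qs: "list_all2 (\<in>) qs (map P ks)"
  shows "br (Poly_Mapping.single n p) (map2 Poly_Mapping.single ks qs) =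
    (\<Sum>js\<in>increasing_seqs (length qs) n. partial_comp \<gamma> I n p js ks qs)"
proof -
  have len: "length ks = length qs" using list_all2_lengthD[OF qs] by simp
  have vanish: "partial_comp \<gamma> I n p js ks qs = 0"
    if "p = 0 \<or> 0 \<in> set qs" and js: "js \<in> increasing_seqs (length qs) n" for js
  proof -
    have mem: "list_all2 (\<in>) (place n js qs I) (map P (place n js ks 1))"
      using list_all2_place[OF js refl, of "\<lambda>q k. q \<in> P k" ks I 1] qs unit_in
      by (simp add: list_all2_map2)
    have "\<gamma> (place n js ks 1) p (place n js qs I) = 0"
      using that(1)
    proof
      assume "p = 0"
      then show ?thesis
        using comp_linear(2)[of 0 "place n js ks 1" "place n js qs I" 0] mem by simp
    next
      assume "0 \<in> set qs"
      then have "0 \<in> set (place n js qs I)" using set_subset_place[OF js refl] by blast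
      then show ?thesis
        using p by (intro multilinear_on_zero[OF comp_multilinear_args mem]) simp_all
    qed
    then show ?thesis by (simp add: partial_comp_def)
  qed
  consider "p = 0" | "p \<noteq> 0" "0 \<in> set qs" | "p \<noteq> 0" "0 \<notin> set qs" by blast
  then show ?thesis
  proof cases
    case 1
    then show ?thesis using vanish by (simp add: operad_bracket_0)
  next
    case 2
    then have "0 \<in> set (map2 Poly_Mapping.single ks qs)" using len by (intro zero_in_singles) simp_all
    then have "listset (map Poly_Mapping.keys (map2 Poly_Mapping.single ks qs)) = {}"
      by (force simp: in_listset_iff list_all2_conv_all_nth in_set_conv_nth)
    then show ?thesis using 2 vanish by (simp add: operad_bracket_def del: map_map)
  next
    case 3
    then show ?thesis using singles_nonzero[OF qs 3(2)] len
      by (simp add: operad_bracket_def del: map_map)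
  qed
qed


text \<open>A strictly increasing sequence of positions among \<open>n\<close> has at most
  \<open>n\<close> entries.\<close>

lemma operad_bracket_single_eq_0:
  assumes "length ws > n"
  shows "br (Poly_Mapping.single n p) ws = 0"
proof -
  have "increasing_seqs (length ws) n = {}"
  proof (rule equals0I)
    fix js assume "js \<in> increasing_seqs (length ws) n"
    then have "card (set js) = length ws" "set js \<subseteq> {1..n}"
      by (auto simp: increasing_seqs_def strict_sorted_iff distinct_card)
    then show False using assms card_mono[of "{1..n}" "set js"] by simp
  qed
  then show ?thesis by (simp add: operad_bracket_def keys_single)
qed

section \<open>The grading by arity minus one\<close>

lemma direct_sum_positive: "P 0 = {0} \<Longrightarrow> direct_sum {1..} P = V"
proof -
  assume P0: "P 0 = {0}"
  show ?thesis
  proof (intro set_eqI iffI)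
    fix x assume x: "x \<in> direct_sum {1..} P"
    show "x \<in> V"
      unfolding in_direct_sum_iff
    proof
      fix n
      show "Poly_Mapping.lookup x n \<in> P n"
      proof (cases "n = 0")
        case True
        then have "n \<notin> Poly_Mapping.keys x" using x by (auto simp: direct_sum_def)
        then show ?thesis by (simp add: in_keys_iff)
      qed (use x in \<open>simp add: direct_sum_def\<close>)
    qed
  next
    fix x assume x: "x \<in> V"
    then have "Poly_Mapping.lookup x 0 = 0" using P0 by (auto simp: in_direct_sum_iff)
    then have "k \<noteq> 0" if "k \<in> Poly_Mapping.keys x" for k
      using that by (metis in_keys_iff)
    then show "x \<in> direct_sum {1..} P" using x by (force simp: direct_sum_def)
  qed
qed

lemma subspace_operad_grading: "DS.subspace (operad_grading P d)"
proof -
  have "0 \<in> operad_grading P d"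
    unfolding operad_grading_def by (rule image_eqI[of _ _ 0]) simp_all
  then show ?thesis
    by (auto simp: DS.subspace_def operad_grading_def direct_sum_scale_single
        subspace_add[OF subspace_P] subspace_scale[OF subspace_P] simp flip: single_add)
qed

lemma operad_grading_decomposition:
  assumes "P 0 = {0}" "v \<in> V"
  shows "\<exists>!f. (\<forall>n. f n \<in> operad_grading P n) \<and> finite {n. f n \<noteq> 0} \<and> v = (\<Sum>n | f n \<noteq> 0. f n)"
proof (rule ex1I)
  let ?f = "\<lambda>n. Poly_Mapping.single (n + 1) (Poly_Mapping.lookup v (n + 1))"
  \<comment> \<open>Degree 0 is arity 1, so a component of arity 0 would be missed by the
    decomposition.\<close>
  have "Poly_Mapping.lookup v 0 = 0" using assms by (auto simp: in_direct_sum_iff)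
  then have "k \<in> Poly_Mapping.keys v \<longleftrightarrow> k \<in> Suc ` {n. Poly_Mapping.lookup v (Suc n) \<noteq> 0}" for k
    by (cases k) (simp_all add: in_keys_iff image_iff)
  then have keys: "Poly_Mapping.keys v = Suc ` {n. ?f n \<noteq> 0}"
    by (simp add: single_eq_0_iff set_eq_iff)
  then have "finite (Suc ` {n. ?f n \<noteq> 0})" by (metis finite_keys)
  then have "finite {n. ?f n \<noteq> 0}" by (rule finite_imageD) simp
  moreover have "v = (\<Sum>n | ?f n \<noteq> 0. ?f n)"
    using sum_single_lookup[of v] unfolding keys by (simp add: sum.reindex)
  moreover have "\<forall>n. ?f n \<in> operad_grading P n"
    using assms(2) by (simp add: operad_grading_def in_direct_sum_iff)
  ultimately show "(\<forall>n. ?f n \<in> operad_grading P n) \<and> finite {n. ?f n \<noteq> 0} \<and> v = (\<Sum>n | ?f n \<noteq> 0. ?f n)"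
    by blast
next
  fix f
  assume f: "(\<forall>n. f n \<in> operad_grading P n) \<and> finite {n. f n \<noteq> 0} \<and> v = (\<Sum>n | f n \<noteq> 0. f n)"
  then have "\<forall>n. \<exists>q. f n = Poly_Mapping.single (n + 1) q" by (auto simp: operad_grading_def)
  then obtain q where q: "\<And>n. f n = Poly_Mapping.single (n + 1) (q n)" by metis
  \<comment> \<open>Uniqueness: the component of degree \<open>n\<close> is read off from
    \<open>v\<close> at arity \<open>n + 1\<close>.\<close>
  have "Poly_Mapping.lookup v (n + 1) = q n" for n
  proof -
    have "Poly_Mapping.lookup v (n + 1) = (\<Sum>m | f m \<noteq> 0. Poly_Mapping.lookup (f m) (n + 1))"
      using f by (simp only: lookup_sum)
    also have "\<dots> = (\<Sum>m | f m \<noteq> 0. if m = n then q m else 0)"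
      by (simp add: q lookup_single when_def)
    also have "\<dots> = q n"
      using f by (simp add: q single_eq_0_iff)
    finally show ?thesis .
  qed
  then show "f = (\<lambda>n. Poly_Mapping.single (n + 1) (Poly_Mapping.lookup v (n + 1)))"
    by (simp add: fun_eq_iff q)
qed

lemma operad_grading_lists:
  assumes "list_all2 (\<in>) ys (map (operad_grading P) ns)"
  obtains qs where "ys = map2 Poly_Mapping.single (map Suc ns) qs" "list_all2 (\<in>) qs (map P (map Suc ns))"
proof -
  have "\<exists>qs. ys = map2 Poly_Mapping.single (map Suc ns) qs \<and> list_all2 (\<in>) qs (map P (map Suc ns))"
    using assms
  proof (induction ns arbitrary: ys)
    case (Cons n ns)
    then obtain y ys' where ys: "ys = y # ys'" and y: "y \<in> operad_grading P n"
      and ys': "list_all2 (\<in>) ys' (map (operad_grading P) ns)" by (auto simp: list_all2_Cons2)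
    from y obtain q where "y = Poly_Mapping.single (Suc n) q" "q \<in> P (Suc n)"
      by (auto simp: operad_grading_def)
    moreover obtain qs where "ys' = map2 Poly_Mapping.single (map Suc ns) qs" "list_all2 (\<in>) qs (map P (map Suc ns))"
      using Cons.IH[OF ys'] by auto
    ultimately show ?case using ys by (intro exI[of _ "q # qs"]) simp
  qed simp
  then show ?thesis using that by blast
qed

text \<open>Filling \<open>k\<close> of the \<open>m + 1\<close> inputs with operations of arities
  one more than the degrees \<open>ns\<close> gives arity \<open>m + 1 - k\<close> plus
  \<open>k + sum_list ns\<close>. The shift by one thus makes degrees additive.\<close>

lemma operad_bracket_graded:
  assumes x: "x \<in> operad_grading P m" and ys: "list_all2 (\<in>) ys (map (operad_grading P) ns)"
  shows "br x ys \<in> operad_grading P (m + sum_list ns)"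
proof -
  obtain p where p: "p \<in> P (Suc m)" "x = Poly_Mapping.single (Suc m) p"
    using x by (auto simp: operad_grading_def)
  obtain qs where qs: "ys = map2 Poly_Mapping.single (map Suc ns) qs" "list_all2 (\<in>) qs (map P (map Suc ns))"
    using operad_grading_lists[OF ys] .
  have len: "length qs = length ns" using list_all2_lengthD[OF qs(2)] by simp
  have "partial_comp \<gamma> I (Suc m) p js (map Suc ns) qs \<in> operad_grading P (m + sum_list ns)"
    if js: "js \<in> increasing_seqs (length qs) (Suc m)" for js
  proof -
    have "sum_list (map Suc ns) = length ns + sum_list ns" by (induction ns) simp_all
    then have deg: "sum_list (place (Suc m) js (map Suc ns) 1) = m + sum_list ns + 1"
      using sum_list_place[OF js, of "map Suc ns"] len by simp
    have mem: "list_all2 (\<in>) (place (Suc m) js qs I) (map P (place (Suc m) js (map Suc ns) 1))"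
      using list_all2_place[OF js refl, of "\<lambda>q k. q \<in> P k" "map Suc ns" I 1] qs(2) unit_in
      by (simp add: list_all2_map2)
    have "\<gamma> (place (Suc m) js (map Suc ns) 1) p (place (Suc m) js qs I) \<in> P (m + sum_list ns + 1)"
      unfolding deg[symmetric] using p(1) mem by (intro comp_closed) simp_all
    then show ?thesis unfolding partial_comp_def deg operad_grading_def by blast
  qed
  then show ?thesis
    unfolding p(2) qs(1) operad_bracket_homogeneous[OF p(1) qs(2)]
    by (rule DS.subspace_sum[OF subspace_operad_grading])
qed

lemma graded_brace_algebra_direct_sum:
  assumes "P 0 = {0}"
  shows "graded_brace_algebra (direct_sum_scale scale) V br (operad_grading P)"
proof -
  interpret brace_algebra "direct_sum_scale scale" V br by (rule brace_algebra_direct_sum)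
  show ?thesis
  proof unfold_locales
    show "operad_grading P n \<subseteq> V" for n by (auto simp: operad_grading_def)
  qed (fact subspace_operad_grading operad_grading_decomposition[OF assms] operad_bracket_graded)+
qed

section \<open>Finite dimension and boundedness\<close>

lemma finite_dimensional_operad_grading:
  assumes "finite_dimensional (P (d + 1))"
  shows "DS.finite_dimensional (operad_grading P d)"
proof -
  obtain B where B: "finite B" "span B = P (d + 1)"
    using assms by (auto simp: finite_dimensional_def)
  interpret L: Vector_Spaces.linear scale "direct_sum_scale scale" "Poly_Mapping.single (d + 1) :: 'v \<Rightarrow> _"
    by unfold_locales (simp_all only: single_add direct_sum_scale_single)
  show ?thesis
    unfolding DS.finite_dimensional_def operad_grading_def
    using B L.span_image[of B] by (intro exI[of _ "Poly_Mapping.single (d + 1) ` B"]) simp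
qed

text \<open>The bound \<open>m + 2\<close> serves for every \<open>n\<close>. If \<open>us\<close>
  is empty, \<open>vs\<close> has more than two letters. If \<open>us\<close> is one element of
  degree \<open>m\<close>, its own degree accounts for at most one zero, so \<open>vs\<close> has
  more letters than its \<open>m + 1\<close> inputs. Longer \<open>us\<close> give 0 by
  definition.\<close>

lemma zero_bounded_operad_bracket:
  assumes "sum_list ps = m" "count_list ps 0 + count_list qs 0 > m + 2"
    and us: "list_all2 (\<in>) us (map (operad_grading P) ps)"
    and vs: "list_all2 (\<in>) vs (map (operad_grading P) qs)"
  shows "extended_bracket br us vs = 0"
proof -
  have len: "length us = length ps" "length vs = length qs"
    using us vs by (auto dest: list_all2_lengthD)
  have count: "count_list qs 0 \<le> length qs" by (rule count_le_length)
  show ?thesis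
  proof (cases us)
    case Nil
    then have "length vs > 2" using assms(2) len count by simp
    then obtain a b vs' where "vs = a # b # vs'" by (cases vs; cases "tl vs") auto
    with Nil show ?thesis by simp
  next
    case (Cons u us')
    show ?thesis
    proof (cases us')
      case Nil
      with Cons have ps: "ps = [m]" using len assms(1) by (cases ps) simp_all
      with us Cons Nil obtain p where u: "u = Poly_Mapping.single (Suc m) p"
        by (auto simp: operad_grading_def)
      have "length vs > Suc m" using assms(2) ps len(2) count by (simp split: if_splits)
      then show ?thesis using Cons Nil by (simp add: u operad_bracket_single_eq_0)
    next
      case (Cons u' us'')
      with \<open>us = u # us'\<close> show ?thesis by simp
    qed
  qed
qed

lemma zero_bounded_brace_algebra_direct_sum:
  assumes "P 0 = {0}" "\<And>n. finite_dimensional (P n)"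
  shows "zero_bounded_brace_algebra (direct_sum_scale scale) V br (operad_grading P)"
proof -
  interpret graded_brace_algebra "direct_sum_scale scale" V br "operad_grading P"
    by (rule graded_brace_algebra_direct_sum[OF assms(1)])
  show ?thesis
  proof unfold_locales
    show "DS.finite_dimensional (operad_grading P n)" for n
      by (rule finite_dimensional_operad_grading[OF assms(2)])
    show "\<exists>B. \<forall>ps qs. sum_list ps = m \<and> sum_list qs = n \<and> count_list ps 0 + count_list qs 0 > B \<longrightarrow>
        (\<forall>us vs. list_all2 (\<in>) us (map (operad_grading P) ps) \<and> list_all2 (\<in>) vs (map (operad_grading P) qs) \<longrightarrow>
            extended_bracket br us vs = 0)" for m n
      using zero_bounded_operad_bracket by blast
  qed
qed

end

theorem proposition37:
  fixes scale :: "'k::field_char_0 \<Rightarrow> 'v::ab_group_add \<Rightarrow> 'v"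
    and P :: "nat \<Rightarrow> 'v set"
    and \<gamma> :: "nat list \<Rightarrow> 'v \<Rightarrow> 'v list \<Rightarrow> 'v"
    and I :: 'v
  assumes "nonsigma_operad scale P \<gamma> I"
    and "P 0 = {0}"
  shows "(\<forall>n p ks qs. p \<in> P n \<longrightarrow> list_all2 (\<in>) qs (map P ks) \<longrightarrow>
            operad_bracket \<gamma> I (Poly_Mapping.single n p) (map2 Poly_Mapping.single ks qs) =
            (\<Sum>js\<in>increasing_seqs (length qs) n. partial_comp \<gamma> I n p js ks qs))
       \<and> brace_algebra (direct_sum_scale scale) (direct_sum {1..} P) (operad_bracket \<gamma> I)
       \<and> graded_brace_algebra (direct_sum_scale scale) (direct_sum {1..} P)
            (operad_bracket \<gamma> I) (operad_grading P)
       \<and> ((\<forall>n. vector_space.finite_dimensional scale (P n)) \<longrightarrow>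
            zero_bounded_brace_algebra (direct_sum_scale scale) (direct_sum {1..} P)
              (operad_bracket \<gamma> I) (operad_grading P))"
proof -
  interpret nonsigma_operad scale P \<gamma> I by fact
  show ?thesis
    unfolding direct_sum_positive[OF assms(2)]
    using operad_bracket_homogeneous brace_algebra_direct_sum graded_brace_algebra_direct_sum[OF assms(2)]
      zero_bounded_brace_algebra_direct_sum[OF assms(2)]
    by blast
qed

end
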